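(* Let $K\ge1$. Let $u(x;\vartheta_t)$ and $g(x;\psi_0)$ be neural networks of identical architecture with $K$ outputs $u_i,g_i$ ($i=1,\dots,K$) and shared hidden layers, under NTK parametrization, with independent $\vartheta_0,\psi_0\sim\mathcal N(0,I)$. Let $\mathcal X$ be a finite training set. In the infinite-width limit, let $u(\cdot;\vartheta_\infty)$ be the $t\to\infty$ limit of gradient flow on $\frac12\|u(\mathcal X;\vartheta_t)-g(\mathcal X;\psi_0)\|_2^2$, let $\epsilon_i(x;\vartheta_\infty,\psi_0)=u_i(x;\vartheta_\infty)-g_i(x;\psi_0)$, and let $$\bar\epsilon^2(x;\vartheta_\infty,\psi_0)=\frac1K\sum_{i=1}^K\epsilon_i^2(x;\vartheta_\infty,\psi_0).$$ Let $f$ be the scalar-output network of the same architecture (apart from the number of outputs), and let $\{f(x;\theta^i_\infty)\}_{i=1}^{K+1}$ be $K+1$ such networks with i.i.d. initializations $\theta_0^i\sim\mathcal N(0,I)$, each trained in the infinite-width limit to $t\to\infty$ by gradient flow on $\frac12\|f(\mathcal X;\theta_t)-\mathcal Y\|_2^2$ for common labels $\mathcal Y$, with sample variance $$\bar\sigma_f^2(x;\theta_\infty^{1,\dots,K+1})=\frac1K\sum_{i=1}^{K+1}\Bigl(f(x;\theta^i_\infty)-\frac1{K+1}\sum_{j=1}^{K+1}f(x;\theta^j_\infty)\Bigr)^2.$$ Assume that the Gram matrix $\Theta_{\mathcal X\mathcal X}$ of the scalar-output NTK $\Theta$ is positive definite. Then for every $x$, $\frac12\bar\epsilon^2(x;\vartheta_\infty,\psi_0)$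 and $\bar\sigma_f^2(x;\theta_\infty^{1,\dots,K+1})$ have the same distribution, namely the scaled chi-squared law $\frac{\Sigma^f_{xx}(\theta_\infty)}{K}\,\chi^2(K)$, where $$\Sigma^f_{xx}(\theta_\infty)=\kappa_{xx}+\Theta_{x\mathcal X}\Theta_{\mathcal X\mathcal X}^{-1}\kappa_{\mathcal X\mathcal X}\Theta_{\mathcal X\mathcal X}^{-1}\Theta_{\mathcal X x}-2\,\Theta_{x\mathcal X}\Theta_{\mathcal X\mathcal X}^{-1}\kappa_{\mathcal X x}.$$
   Context: Networks (NTK parametrization). A fully connected network with $L$ layers, hidden widths $n_1=\dots=n_{L-1}=n$, input dimension $n_0=d_{\rm in}$ and $K$ outputs is defined by $z^l_i(x)=\sigma_b b^l_i+\frac{\sigma_w}{\sqrt{n_{l-1}}}\sum_{j=1}^{n_{l-1}}w^l_{ij}x^l_j(x)$, $x^1(x)=x$, $x^l_j(x)=\phi(z^{l-1}_j(x))$ for $l\ge2$, $f_i(x;\theta)=z^L_i(x)$ for $i=1,\dots,K$, where $\phi:\mathbb R\to\mathbb R$ is a Lipschitz nonlinearity, $\sigma_w,\sigma_b$ are constants and $\theta$ collects all $w^l,b^l$, which are i.i.d. standard normal at initialization. Kernels (scalar output, $K=1$). NNGP kernel: $\kappa(x,x')=\lim_{n\to\infty}\mathbb E_{\theta_0}[f(x;\theta_0)f(x';\theta_0)]$. Neural tangent kernel (NTK): $\Theta(x,x')=\lim_{n\to\infty}\nabla_\theta f(x;\theta_0)^\top\nabla_\theta f(x';\theta_0)$ (deterministic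 limit in probability). The scalar initial function $f(\cdot;\theta_0)$ is in the limit a centered Gaussian process with kernel $\kappa$. Infinite-width regime (standing convention): the initial functions $(f_1(\cdot;\theta_0),\dots,f_K(\cdot;\theta_0))$ are the limit in distribution (of finite-dimensional marginals) as $n\to\infty$; networks with independent parameters have independent limits. The empirical neural tangent kernel is, in the limit, deterministic and constant during training, equal to $\Theta_{ij}(x,x')=\lim_{n\to\infty}\nabla_\theta f_i(x;\theta_0)^\top\nabla_\theta f_j(x';\theta_0)$, so that gradient flow $\frac{d}{dt}\theta_t=-\nabla_\theta\mathcal L(\theta_t)$ on $\frac12\sum_i\|f_i(\mathcal X;\theta_t)-\mathcal Y_i\|_2^2$ becomes the linear ODE $\frac{d}{dt}f_i(x;\theta_t)=-\sum_{j}\Theta_{ij}(x,\mathcal X)\,(f_j(\mathcal X;\theta_t)-\mathcal Y_j)$, started at the limiting initial functions. $\theta_\infty$ denotes the limit $t\to\infty$ of these infinite-width dynamics. Notation. For finite point sets $A,B$, $k_{AB}=(k(a,b))_{a\in A,b\in B}$ for a kernel $k$. $\chi^2(K)$ is the chi-squared distribution with $K$ degrees of freedom. *)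

theory Defs
  imports "HOL-Probability.Probability"
begin

text \<open>
  One index type serves all widths and all numbers of outputs: \<open>Bias l i\<close> is $b^l_i$,
  \<open>InWeight i j\<close> is $w^1_{ij}$ (its second index is a coordinate of the input space) and
  \<open>Weight l i j\<close> is $w^l_{ij}$ for $l \ge 2$. Layers, neurons and outputs are counted from 1.
\<close>

datatype 'd param = Bias nat nat | InWeight nat 'd | Weight nat nat nat

text \<open>
  \<open>preact \<phi> \<sigma>w \<sigma>b n \<theta> x l i\<close> is $z^l_i(x)$ for hidden width \<open>n\<close>; the layer index 0 is a dummy.
\<close>

fun preact ::
  "(real \<Rightarrow> real) \<Rightarrow> real \<Rightarrow> real \<Rightarrow> nat \<Rightarrow> ('d::finite param \<Rightarrow> real) \<Rightarrow> real^'d \<Rightarrow> nat \<Rightarrow> nat \<Rightarrow> real"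
where
  "preact \<phi> \<sigma>w \<sigma>b n \<theta> x 0 i = 0"
| "preact \<phi> \<sigma>w \<sigma>b n \<theta> x (Suc 0) i =
     \<sigma>b * \<theta> (Bias 1 i) + \<sigma>w / sqrt (real CARD('d)) * (\<Sum>j\<in>UNIV. \<theta> (InWeight i j) * x $ j)"
| "preact \<phi> \<sigma>w \<sigma>b n \<theta> x (Suc (Suc l)) i =
     \<sigma>b * \<theta> (Bias (Suc (Suc l)) i)
       + \<sigma>w / sqrt (real n) *
           (\<Sum>j=1..n. \<theta> (Weight (Suc (Suc l)) i j) * \<phi> (preact \<phi> \<sigma>w \<sigma>b n \<theta> x (Suc l) j))"

definition net ::
  "(real \<Rightarrow> real) \<Rightarrow> real \<Rightarrow> real \<Rightarrow> nat \<Rightarrow> nat \<Rightarrow> nat \<Rightarrow> real^'d \<Rightarrow> ('d::finite param \<Rightarrow> real) \<Rightarrow> real"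
where
  "net \<phi> \<sigma>w \<sigma>b L n i x \<theta> = preact \<phi> \<sigma>w \<sigma>b n \<theta> x L i"

definition layer_width :: "nat \<Rightarrow> nat \<Rightarrow> nat \<Rightarrow> nat \<Rightarrow> nat" where
  "layer_width L n K l = (if l = L then K else n)"

definition net_params :: "nat \<Rightarrow> nat \<Rightarrow> nat \<Rightarrow> 'd param set" where
  "net_params L n K =
     {Bias l i | l i. l \<in> {1..L} \<and> i \<in> {1..layer_width L n K l}}
   \<union> {InWeight i j | i j. i \<in> {1..layer_width L n K 1}}
   \<union> {Weight l i j | l i j. l \<in> {2..L} \<and> i \<in> {1..layer_width L n K l} \<and> j \<in> {1..n}}"

text \<open>
  All parameters are i.i.d. standard normal. The product runs over every index of the type; a
  network of given width and number of outputs only reads those in \<open>net_params\<close>.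
\<close>

definition init_measure :: "('d param \<Rightarrow> real) measure" where
  "init_measure = (\<Pi>\<^sub>M p\<in>UNIV. density lborel (\<lambda>y. ennreal (std_normal_density y)))"

text \<open>
  A partial derivative that does not exist is set to 0. For Lipschitz \<open>\<phi>\<close> the network is locally
  Lipschitz in its parameters, so by Rademacher's theorem this affects only a null set of
  initial parameters.
\<close>

definition partial_deriv :: "(('p \<Rightarrow> real) \<Rightarrow> real) \<Rightarrow> 'p \<Rightarrow> ('p \<Rightarrow> real) \<Rightarrow> real" where
  "partial_deriv F p \<theta> =
     (if (\<lambda>t. F (\<theta>(p := t))) differentiable at (\<theta> p)
      then deriv (\<lambda>t. F (\<theta>(p := t))) (\<theta> p) else 0)"

definition empirical_ntk ::
  "(real \<Rightarrow> real) \<Rightarrow> real \<Rightarrow> real \<Rightarrow> nat \<Rightarrow> nat \<Rightarrow> nat \<Rightarrow> nat \<Rightarrow> nat \<Rightarrow> real^'d \<Rightarrow> real^'d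
     \<Rightarrow> ('d::finite param \<Rightarrow> real) \<Rightarrow> real"
where
  "empirical_ntk \<phi> \<sigma>w \<sigma>b L K n i j x x' \<theta> =
     (\<Sum>p\<in>net_params L n K.
        partial_deriv (net \<phi> \<sigma>w \<sigma>b L n i x) p \<theta> * partial_deriv (net \<phi> \<sigma>w \<sigma>b L n j x') p \<theta>)"

definition converges_in_prob_const :: "'a measure \<Rightarrow> (nat \<Rightarrow> 'a \<Rightarrow> real) \<Rightarrow> real \<Rightarrow> bool" where
  "converges_in_prob_const P X c \<longleftrightarrow>
     (\<forall>n. X n \<in> borel_measurable P) \<and>
     (\<forall>e>0. (\<lambda>n. measure P {\<omega> \<in> space P. \<bar>X n \<omega> - c\<bar> > e}) \<longlonglongrightarrow> 0)"

text \<open>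
  Convergence in distribution of the finite-dimensional marginals of processes indexed by \<open>S\<close>,
  tested against bounded continuous functions. A test function lives on the full function space
  with the product topology; it only sees the coordinates in the finite set \<open>A\<close>, because
  \<open>restrict\<close> makes all others constant.
\<close>

definition converges_fdd ::
  "'a measure \<Rightarrow> (nat \<Rightarrow> 's \<Rightarrow> 'a \<Rightarrow> real) \<Rightarrow> 'b measure \<Rightarrow> ('s \<Rightarrow> 'b \<Rightarrow> real) \<Rightarrow> 's set \<Rightarrow> bool"
where
  "converges_fdd P X M Y S \<longleftrightarrow>
     (\<forall>s\<in>S. (\<forall>n. X n s \<in> borel_measurable P) \<and> Y s \<in> borel_measurable M) \<and>
     (\<forall>A (h :: ('s \<Rightarrow> real) \<Rightarrow> real).
        finite A \<and> A \<subseteq> S \<and> continuous_on UNIV h \<and> bounded (range h) \<longrightarrow>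
        (\<lambda>n. integral\<^sup>L P (\<lambda>\<theta>. h (\<lambda>s\<in>A. X n s \<theta>))) \<longlonglongrightarrow> integral\<^sup>L M (\<lambda>\<omega>. h (\<lambda>s\<in>A. Y s \<omega>)))"

definition is_nngp_kernel ::
  "(real \<Rightarrow> real) \<Rightarrow> real \<Rightarrow> real \<Rightarrow> nat \<Rightarrow> (real^'d::finite \<Rightarrow> real^'d \<Rightarrow> real) \<Rightarrow> bool"
where
  "is_nngp_kernel \<phi> \<sigma>w \<sigma>b L \<kappa> \<longleftrightarrow>
     (\<forall>x x'. (\<lambda>n. integral\<^sup>L init_measure
                 (\<lambda>\<theta>. net \<phi> \<sigma>w \<sigma>b L n 1 x \<theta> * net \<phi> \<sigma>w \<sigma>b L n 1 x' \<theta>)) \<longlonglongrightarrow> \<kappa> x x')"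

definition is_ntk ::
  "(real \<Rightarrow> real) \<Rightarrow> real \<Rightarrow> real \<Rightarrow> nat \<Rightarrow> nat
     \<Rightarrow> (nat \<Rightarrow> nat \<Rightarrow> real^'d::finite \<Rightarrow> real^'d \<Rightarrow> real) \<Rightarrow> bool"
where
  "is_ntk \<phi> \<sigma>w \<sigma>b L K \<Theta> \<longleftrightarrow>
     (\<forall>i\<in>{1..K}. \<forall>j\<in>{1..K}. \<forall>x x'.
        converges_in_prob_const init_measure
          (\<lambda>n. empirical_ntk \<phi> \<sigma>w \<sigma>b L K n i j x x') (\<Theta> i j x x'))"

definition is_initial_limit ::
  "(real \<Rightarrow> real) \<Rightarrow> real \<Rightarrow> real \<Rightarrow> nat \<Rightarrow> nat
     \<Rightarrow> 'w measure \<Rightarrow> (nat \<Rightarrow> real^'d::finite \<Rightarrow> 'w \<Rightarrow> real) \<Rightarrow> bool"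
where
  "is_initial_limit \<phi> \<sigma>w \<sigma>b L K M f \<longleftrightarrow>
     converges_fdd init_measure (\<lambda>n (i, x). net \<phi> \<sigma>w \<sigma>b L n i x) M (\<lambda>(i, x). f i x)
       ({1..K} \<times> UNIV)"

text \<open>
  Every finite linear combination has the centered normal law with the variance prescribed by
  the kernel. Variance 0, i.e. the point mass at 0, is allowed, hence the scaling of a standard
  normal instead of a density.
\<close>

definition centered_gaussian_process ::
  "'w measure \<Rightarrow> ('s \<Rightarrow> 's \<Rightarrow> real) \<Rightarrow> ('s \<Rightarrow> 'w \<Rightarrow> real) \<Rightarrow> bool"
where
  "centered_gaussian_process M k f \<longleftrightarrow>
     (\<forall>s. f s \<in> borel_measurable M) \<and>
     (\<forall>A c. finite A \<longrightarrow>
        (let v = (\<Sum>s\<in>A. \<Sum>s'\<in>A. c s * c s' * k s s') in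
           0 \<le> v \<and>
           distr M borel (\<lambda>\<omega>. \<Sum>s\<in>A. c s * f s \<omega>) =
             distr (density lborel (\<lambda>y. ennreal (std_normal_density y))) borel (\<lambda>y. sqrt v * y)))"

text \<open>
  Gradient flow of the squared loss on the training points \<open>X a\<close> with labels \<open>Y i a\<close>, with the
  constant limiting NTK \<open>\<Theta>\<close>; \<open>f t i x\<close> is the \<open>i\<close>-th output at time \<open>t\<close> and \<open>f 0\<close> is the
  initial function.
\<close>

definition ntk_gradient_flow ::
  "(nat \<Rightarrow> nat \<Rightarrow> 'x \<Rightarrow> 'x \<Rightarrow> real) \<Rightarrow> nat \<Rightarrow> ('m::finite \<Rightarrow> 'x) \<Rightarrow> (nat \<Rightarrow> 'm \<Rightarrow> real)
     \<Rightarrow> (real \<Rightarrow> nat \<Rightarrow> 'x \<Rightarrow> real) \<Rightarrow> bool"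
where
  "ntk_gradient_flow \<Theta> K X Y f \<longleftrightarrow>
     (\<forall>i\<in>{1..K}. \<forall>x. \<forall>t\<ge>0.
        ((\<lambda>s. f s i x) has_real_derivative
           - (\<Sum>j=1..K. \<Sum>a\<in>UNIV. \<Theta> i j x (X a) * (f t j (X a) - Y j a))) (at t within {0..}))"

definition kernel_matrix :: "('x \<Rightarrow> 'x \<Rightarrow> real) \<Rightarrow> ('m::finite \<Rightarrow> 'x) \<Rightarrow> real^'m^'m" where
  "kernel_matrix k X = (\<chi> a b. k (X a) (X b))"

definition kernel_row :: "('x \<Rightarrow> 'x \<Rightarrow> real) \<Rightarrow> 'x \<Rightarrow> ('m::finite \<Rightarrow> 'x) \<Rightarrow> real^'m" where
  "kernel_row k x X = (\<chi> a. k x (X a))"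

definition kernel_col :: "('x \<Rightarrow> 'x \<Rightarrow> real) \<Rightarrow> ('m::finite \<Rightarrow> 'x) \<Rightarrow> 'x \<Rightarrow> real^'m" where
  "kernel_col k X x = (\<chi> a. k (X a) x)"

definition positive_definite :: "real^'m^'m \<Rightarrow> bool" where
  "positive_definite A \<longleftrightarrow> transpose A = A \<and> (\<forall>v. v \<noteq> 0 \<longrightarrow> 0 < v \<bullet> (A *v v))"

definition trained_variance ::
  "('x \<Rightarrow> 'x \<Rightarrow> real) \<Rightarrow> ('x \<Rightarrow> 'x \<Rightarrow> real) \<Rightarrow> ('m::finite \<Rightarrow> 'x) \<Rightarrow> 'x \<Rightarrow> real"
where
  "trained_variance \<kappa> \<Theta> X x =
     (let Ti = matrix_inv (kernel_matrix \<Theta> X) in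
        \<kappa> x x
        + kernel_row \<Theta> x X \<bullet> (Ti *v (kernel_matrix \<kappa> X *v (Ti *v kernel_col \<Theta> X x)))
        - 2 * (kernel_row \<Theta> x X \<bullet> (Ti *v kernel_col \<kappa> X x)))"

definition chi_squared :: "nat \<Rightarrow> real measure" where
  "chi_squared K =
     distr (\<Pi>\<^sub>M i\<in>{1..K}. density lborel (\<lambda>y. ennreal (std_normal_density y))) borel
       (\<lambda>z. \<Sum>i=1..K. (z i)\<^sup>2)"

definition mean_squared_error :: "nat \<Rightarrow> (nat \<Rightarrow> real) \<Rightarrow> (nat \<Rightarrow> real) \<Rightarrow> real" where
  "mean_squared_error K u g = 1 / real K * (\<Sum>i=1..K. (u i - g i)\<^sup>2)"

definition sample_variance :: "nat \<Rightarrow> (nat \<Rightarrow> real) \<Rightarrow> real" where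
  "sample_variance K y =
     1 / real K * (\<Sum>i=1..K+1. (y i - 1 / real (K + 1) * (\<Sum>j=1..K+1. y j))\<^sup>2)"

end

theory Submission
  imports Defs
begin

text \<open>
  Given the hidden layers, the $K$ outputs of a network are i.i.d. centered Gaussian, with a random
  variance $V_n$ for a fixed linear combination of values. The scalar limit being Gaussian with
  kernel $\kappa$ forces the Laplace transforms of $V_n$ to converge to those of a constant, so $V_n$
  converges to that constant in probability and the limiting outputs are independent. Flipping the
  sign of the last-layer parameters of one output shows that the off-diagonal blocks of the $K$-output
  NTK vanish, and permuting the outputs shows that the diagonal blocks equal $\Theta$; hence the
  gradient flow decouples, and the trained function is an affine image of the initial one.
  Each error $\epsilon_i$ is then the difference of two independent normals of variance
  $\Sigma^f_{xx}$, and the ensemble members at $x$ are i.i.d. normal of that variance up to a common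
  shift, whose sample variance is a multiple of $\chi^2(K)$ by rotating the scaled mean out.
\<close>

section \<open>Centered normal laws and the sample variance\<close>

text \<open>A Gaussian limit is assumed only for the scalar network; for the \<open>K\<close>-output
  networks just convergence in distribution is given. Their joint law has to come from finite width,
  where the outputs are exactly Gaussian given the hidden layers. The bridge is that for a normal
  variable of random variance \<open>V\<close> the expectation of cos (t * .) is the Laplace
  transform of \<open>V\<close> at t^2/2. Its limits at 1 and 2 are limits of the first two moments
  of exp (- V), and they match those of a constant, so the mean square distance of exp (- V) from
  that constant tends to 0.

  The symmetries of the kernel take the place of derivatives computed through the layers: both
  transformations preserve the initial law, so a limit in probability must be invariant under them.

  The variance of the trained network vanishes when \<open>x\<close> is a training point. Normal
  laws are therefore images of the standard normal law under scaling, and sums go through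
  characteristic functions instead of densities.\<close>

definition centered_normal :: "real \<Rightarrow> real measure" where
  "centered_normal v = distr std_normal_distribution borel (\<lambda>y. sqrt v * y)"

lemma real_distribution_centered_normal: "real_distribution (centered_normal v)"
proof -
  interpret real_distribution std_normal_distribution
    by (rule real_dist_normal_dist)
  show ?thesis
    unfolding centered_normal_def by (intro real_distribution_distr) auto
qed

lemma sets_centered_normal [simp, measurable_cong]: "sets (centered_normal v) = sets borel"
  by (simp add: centered_normal_def)

lemma integral_centered_normal:
  fixes h :: "real \<Rightarrow> real"
  assumes "h \<in> borel_measurable borel"
  shows "(\<integral>y. h y \<partial>centered_normal v) = (\<integral>y. h (sqrt v * y) \<partial>std_normal_distribution)"
  unfolding centered_normal_def using assms by (subst integral_distr) auto

lemma char_centered_normal: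
  assumes "0 \<le> v"
  shows "char (centered_normal v) t = complex_of_real (exp (- (v * t\<^sup>2) / 2))"
proof -
  have "char (centered_normal v) t = (CLINT y|std_normal_distribution. iexp (t * (sqrt v * y)))"
    unfolding char_def centered_normal_def by (subst integral_distr) auto
  also have "\<dots> = char std_normal_distribution (t * sqrt v)"
    unfolding char_def by (simp add: mult.assoc)
  finally show ?thesis
    using assms by (simp add: char_std_normal_distribution power_mult_distrib mult.commute)
qed

lemma integral_cos_centered_normal:
  assumes "0 \<le> v"
  shows "(\<integral>y. cos (t * y) \<partial>centered_normal v) = exp (- (v * t\<^sup>2) / 2)"
proof -
  interpret real_distribution "centered_normal v"
    by (rule real_distribution_centered_normal)
  have "integrable (centered_normal v) (\<lambda>y. iexp (t * y))"
    by (rule integrable_iexp) auto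
  then have "(\<integral>y. Re (iexp (t * y)) \<partial>centered_normal v) = Re (char (centered_normal v) t)"
    unfolding char_def by (rule integral_Re)
  then show ?thesis
    using assms by (simp add: char_centered_normal Re_exp)
qed

text \<open>Characteristic functions of independent summands multiply, so the exponents add up.
  Densities would not do, since any \<open>a i\<close> and \<open>v i\<close> may be 0.\<close>

lemma (in prob_space) distr_sum_centered_normal:
  assumes "finite I" and indep: "indep_vars (\<lambda>_. borel) X I"
    and law: "\<And>i. i \<in> I \<Longrightarrow> distr M borel (X i) = centered_normal (v i)"
    and v: "\<And>i. i \<in> I \<Longrightarrow> 0 \<le> v i"
  shows "distr M borel (\<lambda>\<omega>. \<Sum>i\<in>I. a i * X i \<omega>) = centered_normal (\<Sum>i\<in>I. (a i)\<^sup>2 * v i)"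
proof (rule Levy_uniqueness)
  have rv [measurable]: "random_variable borel (X i)" if "i \<in> I" for i
    using indep that by (auto simp: indep_vars_def)
  show "real_distribution (distr M borel (\<lambda>\<omega>. \<Sum>i\<in>I. a i * X i \<omega>))"
    by (intro real_distribution_distr) measurable
  show "real_distribution (centered_normal (\<Sum>i\<in>I. (a i)\<^sup>2 * v i))"
    by (rule real_distribution_centered_normal)
  have scaled: "char (distr M borel (\<lambda>\<omega>. a i * X i \<omega>)) t = exp (- ((a i)\<^sup>2 * v i * t\<^sup>2) / 2)"
    if i: "i \<in> I" for i t
  proof -
    have "char (distr M borel (\<lambda>\<omega>. a i * X i \<omega>)) t = char (distr M borel (X i)) (a i * t)"
      unfolding char_def using i
      by (subst (1 2) integral_distr) (auto simp: mult_ac)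
    then show ?thesis
      using i by (simp add: law v char_centered_normal power_mult_distrib mult_ac)
  qed
  show "char (distr M borel (\<lambda>\<omega>. \<Sum>i\<in>I. a i * X i \<omega>)) = char (centered_normal (\<Sum>i\<in>I. (a i)\<^sup>2 * v i))"
  proof
    fix t
    have "indep_vars (\<lambda>_. borel) (\<lambda>i \<omega>. a i * X i \<omega>) I"
      by (rule indep_vars_compose2[OF indep]) measurable
    then have "char (distr M borel (\<lambda>\<omega>. \<Sum>i\<in>I. a i * X i \<omega>)) t =
        (\<Prod>i\<in>I. complex_of_real (exp (- ((a i)\<^sup>2 * v i * t\<^sup>2) / 2)))"
      by (simp add: char_distr_sum scaled)
    also have "\<dots> = complex_of_real (exp (- ((\<Sum>i\<in>I. (a i)\<^sup>2 * v i) * t\<^sup>2) / 2))"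
      using \<open>finite I\<close>
      by (simp add: exp_sum[symmetric] sum_distrib_right sum_negf sum_divide_distrib flip: of_real_prod)
    finally show "char (distr M borel (\<lambda>\<omega>. \<Sum>i\<in>I. a i * X i \<omega>)) t =
        char (centered_normal (\<Sum>i\<in>I. (a i)\<^sup>2 * v i)) t"
      using v by (simp add: char_centered_normal sum_nonneg)
  qed
qed

text \<open>The joint density depends only on x^2 + y^2, hence is invariant under rotation. The
  change of variables is split into two affine ones on the line: x at fixed y, then y at fixed u = c
  x + s y. Their Jacobians 1/|c| and |c| cancel, and the first one is where \<open>c\<close> has to
  be nonzero.\<close>

lemma nn_integral_std_normal_rotation:
  fixes c s :: real and f :: "real \<times> real \<Rightarrow> ennreal"
  assumes [measurable]: "f \<in> borel_measurable (borel \<Otimes>\<^sub>M borel)"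
    and cs: "c\<^sup>2 + s\<^sup>2 = 1" and c: "c \<noteq> 0"
  shows "(\<integral>\<^sup>+x. \<integral>\<^sup>+y. f (c * x + s * y, c * y - s * x) \<partial>std_normal_distribution \<partial>std_normal_distribution) =
    (\<integral>\<^sup>+x. \<integral>\<^sup>+y. f (x, y) \<partial>std_normal_distribution \<partial>std_normal_distribution)"
proof -
  define D :: "real \<Rightarrow> real \<Rightarrow> ennreal"
    where "D x y = ennreal (std_normal_density x) * ennreal (std_normal_density y)" for x y
  have [measurable]: "(\<lambda>(x, y). D x y) \<in> borel_measurable (borel \<Otimes>\<^sub>M borel)"
    unfolding D_def by measurable
  have D_rotate: "D (c * u - s * w) (s * u + c * w) = D u w" for u w
  proof -
    have "(c * u - s * w)\<^sup>2 + (s * u + c * w)\<^sup>2 = (c\<^sup>2 + s\<^sup>2) * (u\<^sup>2 + w\<^sup>2)"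
      by (simp add: power2_eq_square algebra_simps)
    then have "exp (- (c * u - s * w)\<^sup>2 / 2) * exp (- (s * u + c * w)\<^sup>2 / 2) =
        exp (- u\<^sup>2 / 2) * exp (- w\<^sup>2 / 2)"
      by (simp add: cs flip: exp_add add_divide_distrib)
    then show ?thesis
      unfolding D_def std_normal_density_def by (simp flip: ennreal_mult)
  qed
  have density: "(\<integral>\<^sup>+x. \<integral>\<^sup>+y. g x y \<partial>std_normal_distribution \<partial>std_normal_distribution) =
      (\<integral>\<^sup>+x. \<integral>\<^sup>+y. D x y * g x y \<partial>lborel \<partial>lborel)"
    if [measurable]: "case_prod g \<in> borel_measurable (borel \<Otimes>\<^sub>M borel)" for g
    unfolding D_def by (simp add: nn_integral_density nn_integral_cmult mult.assoc)
  let ?F = "\<lambda>x y. D x y * f (c * x + s * y, c * y - s * x)"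
  have F [measurable]: "case_prod ?F \<in> borel_measurable (borel \<Otimes>\<^sub>M borel)"
    by measurable
  have "(\<integral>\<^sup>+x. \<integral>\<^sup>+y. ?F x y \<partial>lborel \<partial>lborel) = (\<integral>\<^sup>+y. \<integral>\<^sup>+x. ?F x y \<partial>lborel \<partial>lborel)"
    by (rule lborel_pair.Fubini'[symmetric]) measurable
  also have "\<dots> = (\<integral>\<^sup>+y. ennreal \<bar>1 / c\<bar> * (\<integral>\<^sup>+u. ?F (- (s / c * y) + 1 / c * u) y \<partial>lborel) \<partial>lborel)"
    using c by (intro nn_integral_cong nn_integral_real_affine) auto
  also have "\<dots> = ennreal \<bar>1 / c\<bar> * (\<integral>\<^sup>+y. \<integral>\<^sup>+u. ?F (- (s / c * y) + 1 / c * u) y \<partial>lborel \<partial>lborel)"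
    by (rule nn_integral_cmult) measurable
  also have "(\<integral>\<^sup>+y. \<integral>\<^sup>+u. ?F (- (s / c * y) + 1 / c * u) y \<partial>lborel \<partial>lborel) =
      (\<integral>\<^sup>+u. \<integral>\<^sup>+y. ?F (- (s / c * y) + 1 / c * u) y \<partial>lborel \<partial>lborel)"
    by (rule lborel_pair.Fubini') measurable
  \<comment> \<open>Second substitution y = s u + c w, under which x becomes c u - s w and c y - s x
    becomes w.\<close>
  also have "\<dots> = (\<integral>\<^sup>+u. ennreal \<bar>c\<bar> *
      (\<integral>\<^sup>+w. ?F (- (s / c * (s * u + c * w)) + 1 / c * u) (s * u + c * w) \<partial>lborel) \<partial>lborel)"
    using c by (intro nn_integral_cong nn_integral_real_affine) auto
  also have "\<dots> = (\<integral>\<^sup>+u. ennreal \<bar>c\<bar> * (\<integral>\<^sup>+w. D u w * f (u, w) \<partial>lborel) \<partial>lborel)"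
  proof -
    have s2: "s\<^sup>2 = 1 - c\<^sup>2" using cs by simp
    have "?F (- (s / c * (s * u + c * w)) + 1 / c * u) (s * u + c * w) = D u w * f (u, w)" for u w
    proof -
      have "c * (- (s / c * (s * u + c * w)) + 1 / c * u) = (1 - s\<^sup>2) * u - s * c * w"
        using c by (simp add: field_simps power2_eq_square)
      also have "\<dots> = c * (c * u - s * w)"
        unfolding s2 by (simp add: algebra_simps power2_eq_square)
      finally have x: "- (s / c * (s * u + c * w)) + 1 / c * u = c * u - s * w"
        using c by simp
      have "c * (c * u - s * w) + s * (s * u + c * w) = (c\<^sup>2 + s\<^sup>2) * u"
        "c * (s * u + c * w) - s * (c * u - s * w) = (c\<^sup>2 + s\<^sup>2) * w"
        by (simp_all add: power2_eq_square algebra_simps)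
      then show ?thesis
        by (simp only: x D_rotate) (simp add: cs)
    qed
    then show ?thesis by simp
  qed
  also have "\<dots> = ennreal \<bar>c\<bar> * (\<integral>\<^sup>+u. \<integral>\<^sup>+w. D u w * f (u, w) \<partial>lborel \<partial>lborel)"
    by (rule nn_integral_cmult) measurable
  also have "ennreal \<bar>1 / c\<bar> * \<dots> = (\<integral>\<^sup>+u. \<integral>\<^sup>+w. D u w * f (u, w) \<partial>lborel \<partial>lborel)"
    using c by (simp add: mult.assoc[symmetric] ennreal_mult[symmetric])
  finally show ?thesis
    by (simp add: density)
qed

lemma sum_squared_deviations:
  fixes z :: "'i \<Rightarrow> real"
  assumes "finite I" "I \<noteq> {}"
  shows "(\<Sum>i\<in>I. (z i - 1 / real (card I) * (\<Sum>j\<in>I. z j))\<^sup>2) =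
    (\<Sum>i\<in>I. (z i)\<^sup>2) - (\<Sum>j\<in>I. z j)\<^sup>2 / real (card I)"
proof -
  define T where "T = (\<Sum>j\<in>I. z j)"
  have n: "real (card I) \<noteq> 0" using assms by simp
  have expand: "(\<Sum>i\<in>I. (z i - m)\<^sup>2) = (\<Sum>i\<in>I. (z i)\<^sup>2) - 2 * m * (\<Sum>i\<in>I. z i) + card I * m\<^sup>2" for m :: real
    by (simp add: power2_diff sum.distrib sum_subtractf flip: sum_distrib_left sum_distrib_right)
  have "(\<Sum>i\<in>I. (z i - 1 / real (card I) * T)\<^sup>2) =
      (\<Sum>i\<in>I. (z i)\<^sup>2) - 2 * (T / card I) * (\<Sum>i\<in>I. z i) + card I * (T / card I)\<^sup>2"
    unfolding expand by simp
  also have "\<dots> = (\<Sum>i\<in>I. (z i)\<^sup>2) - T\<^sup>2 / card I"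
    using n by (simp add: T_def[symmetric] field_simps power2_eq_square)
  finally show ?thesis by (simp add: T_def)
qed

text \<open>
  The scaled mean is carried along because the induction step rotates it against the new
  coordinate; the sum of squared deviations then grows by the square of the other rotated coordinate.
\<close>

lemma nn_integral_mean_deviations:
  fixes f :: "real \<times> real \<Rightarrow> ennreal"
  assumes "f \<in> borel_measurable (borel \<Otimes>\<^sub>M borel)"
  shows "(\<integral>\<^sup>+z. f ((\<Sum>i=1..Suc n. z i) / sqrt (real (Suc n)),
        (\<Sum>i=1..Suc n. (z i)\<^sup>2) - (\<Sum>i=1..Suc n. z i)\<^sup>2 / real (Suc n))
      \<partial>(\<Pi>\<^sub>M i\<in>{1..Suc n}. std_normal_distribution)) =
    (\<integral>\<^sup>+u. \<integral>\<^sup>+z. f (u, \<Sum>i=1..n. (z i)\<^sup>2) \<partial>(\<Pi>\<^sub>M i\<in>{1..n}. std_normal_distribution)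
      \<partial>std_normal_distribution)"
  using assms
proof (induction n arbitrary: f)
  case 0
  interpret product_sigma_finite "\<lambda>_::nat. std_normal_distribution"
    unfolding product_sigma_finite_def
    using prob_space_normal_density[of 1 0] prob_space_imp_sigma_finite by auto
  have [measurable]: "f \<in> borel_measurable (borel \<Otimes>\<^sub>M borel)" by fact
  show ?case
    by (simp add: product_nn_integral_singleton[of "\<lambda>u. f (u, 0)" "Suc 0"] space_PiM_empty
        nn_integral_count_space_finite PiM_empty)
next
  case (Suc n)
  interpret product_sigma_finite "\<lambda>_::nat. std_normal_distribution"
    unfolding product_sigma_finite_def
    using prob_space_normal_density[of 1 0] prob_space_imp_sigma_finite by auto
  interpret std: prob_space std_normal_distribution
    using prob_space_normal_density by auto
  interpret pair_sigma_finite std_normal_distribution std_normal_distribution ..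
  have f [measurable]: "f \<in> borel_measurable (borel \<Otimes>\<^sub>M borel)" by fact
  \<comment> \<open>The weights with which the scaled mean of n + 1 coordinates and the new
    coordinate combine to the scaled mean of n + 2 coordinates; their squares are (n + 1)/(n + 2)
    and 1/(n + 2).\<close>
  define c s where "c = sqrt (real (Suc n)) / sqrt (real (Suc (Suc n)))"
    and "s = 1 / sqrt (real (Suc (Suc n)))"
  have c0: "c \<noteq> 0" and cs: "c\<^sup>2 + s\<^sup>2 = 1"
    by (simp_all add: c_def s_def power_divide field_simps)
  let ?P = "\<lambda>n. \<Pi>\<^sub>M i\<in>{1..n}. std_normal_distribution"
  interpret P: finite_product_sigma_finite "\<lambda>_::nat. std_normal_distribution" "{1..n}"
    by standard simp
  let ?m = "\<lambda>n z. (\<Sum>i=1..n. z i) / sqrt (real n)"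
  let ?S = "\<lambda>n z. (\<Sum>i=1..n. (z i)\<^sup>2) - (\<Sum>i=1..n. z i)\<^sup>2 / real n"
  have insert: "{1..Suc k} = insert (Suc k) {1..k}" for k by auto
  have step: "?m (Suc (Suc n)) (z(Suc (Suc n) := y)) = c * ?m (Suc n) z + s * y"
    "?S (Suc (Suc n)) (z(Suc (Suc n) := y)) = ?S (Suc n) z + (c * y - s * ?m (Suc n) z)\<^sup>2" for z y
  proof -
    let ?T = "\<Sum>i=1..Suc n. z i"
    have sums: "(\<Sum>i=1..Suc (Suc n). (z(Suc (Suc n) := y)) i) = ?T + y"
      "(\<Sum>i=1..Suc (Suc n). ((z(Suc (Suc n) := y)) i)\<^sup>2) = (\<Sum>i=1..Suc n. (z i)\<^sup>2) + y\<^sup>2"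
      unfolding insert[of "Suc n"] by (simp_all add: add.commute)
    show "?m (Suc (Suc n)) (z(Suc (Suc n) := y)) = c * ?m (Suc n) z + s * y"
      unfolding sums c_def s_def by (simp add: field_simps del: sum.cl_ivl_Suc)
    have "(c * y - s * ?m (Suc n) z)\<^sup>2 =
        (sqrt (real (Suc n)) * y - ?T / sqrt (real (Suc n)))\<^sup>2 / real (Suc (Suc n))"
      unfolding c_def s_def by (simp add: field_simps del: sum.cl_ivl_Suc)
    also have "(sqrt (real (Suc n)) * y - ?T / sqrt (real (Suc n)))\<^sup>2 =
        real (Suc n) * y\<^sup>2 - 2 * y * ?T + ?T\<^sup>2 / real (Suc n)"
      by (simp add: power2_diff power_mult_distrib power_divide del: sum.cl_ivl_Suc of_nat_Suc)
    finally have square: "(c * y - s * ?m (Suc n) z)\<^sup>2 =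
        (real (Suc n) * y\<^sup>2 - 2 * y * ?T + ?T\<^sup>2 / real (Suc n)) / real (Suc (Suc n))" .
    \<comment> \<open>Here \<open>a\<close> stands for n + 1. Writing \<open>q\<close> for T^2 / a
      leaves 1 + a as the only denominator.\<close>
    have "Q + y\<^sup>2 - (T + y)\<^sup>2 / (1 + a) = Q - T\<^sup>2 / a + (a * y\<^sup>2 - 2 * y * T + T\<^sup>2 / a) / (1 + a)"
      if "a > 0" for Q T a :: real
    proof -
      define q where "q = T\<^sup>2 / a"
      have "T\<^sup>2 = a * q" "1 + a \<noteq> 0" using that by (simp_all add: q_def)
      then have "Q + y\<^sup>2 - (T + y)\<^sup>2 / (1 + a) = Q - q + (a * y\<^sup>2 - 2 * y * T + q) / (1 + a)"
        by (simp add: field_simps power2_sum)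
      then show ?thesis by (simp add: q_def)
    qed
    from this[of "real (Suc n)" "\<Sum>i=1..Suc n. (z i)\<^sup>2" ?T]
    show "?S (Suc (Suc n)) (z(Suc (Suc n) := y)) = ?S (Suc n) z + (c * y - s * ?m (Suc n) z)\<^sup>2"
      unfolding sums square of_nat_Suc[of "Suc n"] by (simp del: sum.cl_ivl_Suc of_nat_Suc)
  qed
  let ?g = "\<lambda>y p. f (c * fst p + s * y, snd p + (c * y - s * fst p)\<^sup>2)"
  have "(\<integral>\<^sup>+z. f (?m (Suc (Suc n)) z, ?S (Suc (Suc n)) z) \<partial>?P (Suc (Suc n))) =
      (\<integral>\<^sup>+y. \<integral>\<^sup>+z. f (?m (Suc (Suc n)) (z(Suc (Suc n) := y)), ?S (Suc (Suc n)) (z(Suc (Suc n) := y)))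
        \<partial>?P (Suc n) \<partial>std_normal_distribution)"
    unfolding insert[of "Suc n"]
    by (rule product_nn_integral_insert_rev) (auto intro!: measurable_compose[OF _ f])
  also have "\<dots> = (\<integral>\<^sup>+y. \<integral>\<^sup>+z. ?g y (?m (Suc n) z, ?S (Suc n) z) \<partial>?P (Suc n) \<partial>std_normal_distribution)"
    unfolding step by (simp del: sum.cl_ivl_Suc)
  also have "\<dots> = (\<integral>\<^sup>+y. \<integral>\<^sup>+u. \<integral>\<^sup>+z. ?g y (u, \<Sum>i=1..n. (z i)\<^sup>2) \<partial>?P n
      \<partial>std_normal_distribution \<partial>std_normal_distribution)"
    by (intro nn_integral_cong Suc.IH) measurable
  also have "\<dots> = (\<integral>\<^sup>+u. \<integral>\<^sup>+y. \<integral>\<^sup>+z. ?g y (u, \<Sum>i=1..n. (z i)\<^sup>2) \<partial>?P n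
      \<partial>std_normal_distribution \<partial>std_normal_distribution)"
    by (rule Fubini') measurable
  also have "\<dots> = (\<integral>\<^sup>+u. \<integral>\<^sup>+y. (\<lambda>(u, w). \<integral>\<^sup>+z. f (u, (\<Sum>i=1..n. (z i)\<^sup>2) + w\<^sup>2) \<partial>?P n)
      (c * u + s * y, c * y - s * u) \<partial>std_normal_distribution \<partial>std_normal_distribution)"
    by simp
  also have "\<dots> = (\<integral>\<^sup>+u. \<integral>\<^sup>+w. (\<lambda>(u, w). \<integral>\<^sup>+z. f (u, (\<Sum>i=1..n. (z i)\<^sup>2) + w\<^sup>2) \<partial>?P n)
      (u, w) \<partial>std_normal_distribution \<partial>std_normal_distribution)"
    by (rule nn_integral_std_normal_rotation[OF _ cs c0]) measurable
  \<comment> \<open>After the rotation w is a fresh standard normal variable; it becomes coordinate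
    n + 1 of the sum of squares.\<close>
  also have "\<dots> = (\<integral>\<^sup>+u. \<integral>\<^sup>+w. \<integral>\<^sup>+z. f (u, \<Sum>i=1..Suc n. ((z(Suc n := w)) i)\<^sup>2) \<partial>?P n
      \<partial>std_normal_distribution \<partial>std_normal_distribution)"
    unfolding insert by (simp add: add.commute)
  also have "\<dots> = (\<integral>\<^sup>+u. \<integral>\<^sup>+z. f (u, \<Sum>i=1..Suc n. (z i)\<^sup>2) \<partial>?P (Suc n) \<partial>std_normal_distribution)"
    unfolding insert
    by (intro nn_integral_cong product_nn_integral_insert_rev[symmetric])
      (auto intro!: measurable_compose[OF _ f])
  finally show ?case .
qed

text \<open>A test function of the second component alone lets the scaled mean integrate out with
  total mass 1; this is the one degree of freedom lost among n + 1 coordinates.\<close>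

theorem distr_sample_variance_std_normal:
  "distr (\<Pi>\<^sub>M i\<in>{1..n+1}. std_normal_distribution) borel
      (\<lambda>z. \<Sum>i=1..n+1. (z i - 1 / real (n + 1) * (\<Sum>j=1..n+1. z j))\<^sup>2) = chi_squared n"
proof (rule measure_eqI)
  interpret std: prob_space std_normal_distribution
    using prob_space_normal_density by auto
  fix A assume "A \<in> sets (distr (\<Pi>\<^sub>M i\<in>{1..n+1}. std_normal_distribution) borel
      (\<lambda>z. \<Sum>i=1..n+1. (z i - 1 / real (n + 1) * (\<Sum>j=1..n+1. z j))\<^sup>2))"
  then have A [measurable]: "A \<in> sets borel" by simp
  let ?P = "\<lambda>n. \<Pi>\<^sub>M i\<in>{1..n}. std_normal_distribution"
  let ?f = "\<lambda>p :: real \<times> real. indicator A (snd p) :: ennreal"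
  have dev: "(\<Sum>i=1..n+1. (z i - 1 / real (n + 1) * (\<Sum>j=1..n+1. z j))\<^sup>2) =
      (\<Sum>i=1..Suc n. (z i)\<^sup>2) - (\<Sum>i=1..Suc n. z i)\<^sup>2 / real (Suc n)" for z :: "nat \<Rightarrow> real"
    using sum_squared_deviations[of "{1..Suc n}" z] by simp
  have "emeasure (distr (?P (n+1)) borel
      (\<lambda>z. \<Sum>i=1..n+1. (z i - 1 / real (n + 1) * (\<Sum>j=1..n+1. z j))\<^sup>2)) A =
      (\<integral>\<^sup>+z. indicator A ((\<Sum>i=1..Suc n. (z i)\<^sup>2) - (\<Sum>i=1..Suc n. z i)\<^sup>2 / real (Suc n)) \<partial>?P (Suc n))"
    unfolding dev
    by (subst nn_integral_indicator[symmetric], simp, subst nn_integral_distr) (simp_all del: sum.cl_ivl_Suc)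
  also have "\<dots> = (\<integral>\<^sup>+u. \<integral>\<^sup>+z. ?f (u, \<Sum>i=1..n. (z i)\<^sup>2) \<partial>?P n \<partial>std_normal_distribution)"
    by (subst nn_integral_mean_deviations[symmetric]) (simp_all del: sum.cl_ivl_Suc)
  also have "\<dots> = (\<integral>\<^sup>+z. indicator A (\<Sum>i=1..n. (z i)\<^sup>2) \<partial>?P n)"
    by (simp add: std.emeasure_space_1[simplified])
  also have "\<dots> = emeasure (chi_squared n) A"
    unfolding chi_squared_def
    by (subst nn_integral_indicator[symmetric], simp, subst nn_integral_distr) simp_all
  finally show "emeasure (distr (?P (n+1)) borel
      (\<lambda>z. \<Sum>i=1..n+1. (z i - 1 / real (n + 1) * (\<Sum>j=1..n+1. z j))\<^sup>2)) A = emeasure (chi_squared n) A" .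
qed (simp add: chi_squared_def)

section \<open>Independent blocks of Gaussian parameters\<close>

text \<open>Replacing the coordinates in \<open>J\<close> by an independent copy turns conditioning
  on the other coordinates into an iterated integral. On cylinder sets it holds because the preimage
  is a rectangle of two cylinders.\<close>

lemma distr_PiM_resample:
  fixes M :: "'i \<Rightarrow> 'a measure"
  assumes M: "\<And>i. prob_space (M i)"
  shows "distr (PiM UNIV M \<Otimes>\<^sub>M PiM UNIV M) (PiM UNIV M) (\<lambda>(x, y) i. if i \<in> J then y i else x i) =
    PiM UNIV M" (is "distr ?PP ?P ?T = _")
proof (rule measure_eqI_PiM_infinite[symmetric, OF refl])
  interpret P: prob_space ?P
    using M by (intro prob_space_PiM) auto
  show "finite_measure ?P"
    by unfold_locales
  fix F A assume F: "finite F" "F \<subseteq> UNIV" and A: "\<And>i. i \<in> F \<Longrightarrow> A i \<in> sets (M i)"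
  let ?E = "\<lambda>G. prod_emb UNIV M G (Pi\<^sub>E G A)"
  have T [measurable]: "?T \<in> measurable ?PP ?P"
  proof (rule measurable_PiM_single')
    fix i
    show "(\<lambda>\<omega>. ?T \<omega> i) \<in> measurable ?PP (M i)"
      by (cases "i \<in> J") (simp_all add: case_prod_beta)
  qed (auto simp: space_pair_measure space_PiM PiE_iff)
  have "emeasure (distr ?PP ?P ?T) (?E F) = emeasure ?PP (?T -` ?E F \<inter> space ?PP)"
    using F A by (intro emeasure_distr T sets_PiM_I) auto
  also have "?T -` ?E F \<inter> space ?PP = ?E (F - J) \<times> ?E (F \<inter> J)"
    by (auto simp: prod_emb_def space_pair_measure space_PiM PiE_iff split: if_splits)
  also have "emeasure ?PP \<dots> = emeasure ?P (?E (F - J)) * emeasure ?P (?E (F \<inter> J))"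
    using F A by (intro P.emeasure_pair_measure_Times sets_PiM_I) auto
  also have "\<dots> = (\<Prod>i\<in>F - J. emeasure (M i) (A i)) * (\<Prod>i\<in>F \<inter> J. emeasure (M i) (A i))"
    using F A M by (intro arg_cong2[where f = "(*)"] emeasure_PiM_emb) auto
  also have "\<dots> = (\<Prod>i\<in>F. emeasure (M i) (A i))"
    using F by (subst prod.union_disjoint[symmetric]) (auto intro!: prod.cong)
  also have "\<dots> = emeasure ?P (?E F)"
    using F A M by (intro emeasure_PiM_emb[symmetric]) auto
  finally show "emeasure ?P (?E F) = emeasure (distr ?PP ?P ?T) (?E F)" ..
qed simp

lemma distr_PiM_componentwise:
  fixes M :: "'i \<Rightarrow> 'a measure"
  assumes M: "\<And>i. prob_space (M i)"
    and g: "\<And>i. g i \<in> measurable (M i) (M i)" "\<And>i. distr (M i) (M i) (g i) = M i"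
  shows "distr (PiM UNIV M) (PiM UNIV M) (\<lambda>x i. g i (x i)) = PiM UNIV M" (is "distr ?P _ ?T = _")
proof (rule measure_eqI_PiM_infinite[symmetric, OF refl])
  interpret P: prob_space ?P
    using M by (intro prob_space_PiM) auto
  show "finite_measure ?P"
    by unfold_locales
  fix F A assume F: "finite F" "F \<subseteq> UNIV" and A: "\<And>i. i \<in> F \<Longrightarrow> A i \<in> sets (M i)"
  have T: "?T \<in> measurable ?P ?P"
    using g(1) by (intro measurable_PiM_single')
      (auto simp: space_PiM PiE_iff intro!: measurable_space[OF g(1)] measurable_compose[OF _ g(1)])
  have "emeasure (distr ?P ?P ?T) (prod_emb UNIV M F (Pi\<^sub>E F A)) =
      emeasure ?P (?T -` prod_emb UNIV M F (Pi\<^sub>E F A) \<inter> space ?P)"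
    using F A by (intro emeasure_distr T sets_PiM_I) auto
  also have "?T -` prod_emb UNIV M F (Pi\<^sub>E F A) \<inter> space ?P =
      prod_emb UNIV M F (\<Pi>\<^sub>E i\<in>F. g i -` A i \<inter> space (M i))"
    by (auto simp: prod_emb_def space_PiM PiE_iff intro!: measurable_space[OF g(1)])
  also have "emeasure ?P \<dots> = (\<Prod>i\<in>F. emeasure (M i) (g i -` A i \<inter> space (M i)))"
    using F A M by (intro emeasure_PiM_emb) (auto intro: measurable_sets[OF g(1)])
  also have "\<dots> = (\<Prod>i\<in>F. emeasure (M i) (A i))"
    using A by (intro prod.cong refl, subst (2) g(2)[symmetric]) (simp add: emeasure_distr g(1))
  also have "\<dots> = emeasure ?P (prod_emb UNIV M F (Pi\<^sub>E F A))"
    using F A M by (intro emeasure_PiM_emb[symmetric]) auto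
  finally show "emeasure ?P (prod_emb UNIV M F (Pi\<^sub>E F A)) =
      emeasure (distr ?P ?P ?T) (prod_emb UNIV M F (Pi\<^sub>E F A))" ..
qed simp

lemma indep_vars_PiM_coordinates:
  fixes M :: "'i \<Rightarrow> 'a measure"
  assumes M: "\<And>i. i \<in> I \<Longrightarrow> prob_space (M i)"
  shows "prob_space.indep_vars (PiM I M) M (\<lambda>i x. x i) I"
proof (cases "I = {}")
  case True
  interpret prob_space "PiM I M"
    using M by (rule prob_space_PiM)
  show ?thesis
    unfolding indep_vars_def2 indep_sets_def using True by auto
next
  case False
  interpret prob_space "PiM I M"
    using M by (rule prob_space_PiM)
  have "distr (PiM I M) (PiM I M) (\<lambda>x. \<lambda>i\<in>I. x i) = distr (PiM I M) (PiM I M) (\<lambda>x. x)"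
    by (intro distr_cong) (auto simp: space_PiM)
  also have "\<dots> = (\<Pi>\<^sub>M i\<in>I. distr (PiM I M) (M i) (\<lambda>x. x i))"
    using M by (simp add: distr_id2 distr_PiM_component cong: PiM_cong)
  finally show ?thesis
    using False by (subst indep_vars_iff_distr_eq_PiM') auto
qed

lemma prob_space_std_normal: "prob_space std_normal_distribution"
  by (simp add: prob_space_normal_density)

lemma centered_normal_1: "centered_normal 1 = std_normal_distribution"
  unfolding centered_normal_def real_sqrt_one mult_1_left by (rule distr_id2) simp

text \<open>The blocks are resampled from a second copy of the parameters. By \<open>a_cong\<close>
  the coefficients then stay those of the first copy, so for fixed first copy the sums are linear
  forms in disjoint sets of independent standard normals: independent, centered normal, with the sum
  of squared coefficients as variance.\<close>

lemma integral_prod_std_normal_blocks: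
  fixes a :: "'p \<Rightarrow> ('p \<Rightarrow> real) \<Rightarrow> real" and h :: "'i \<Rightarrow> real \<Rightarrow> real" and B :: "'i \<Rightarrow> 'p set"
  defines "P \<equiv> \<Pi>\<^sub>M p\<in>UNIV. std_normal_distribution"
  assumes I: "finite I" and B: "\<And>i. i \<in> I \<Longrightarrow> finite (B i)" "disjoint_family_on B I"
    and h: "\<And>i. i \<in> I \<Longrightarrow> h i \<in> borel_measurable borel" "\<And>i y. i \<in> I \<Longrightarrow> \<bar>h i y\<bar> \<le> C"
    and a: "\<And>p. a p \<in> borel_measurable P"
    and a_cong: "\<And>p \<theta> \<theta>'. (\<And>q. q \<notin> (\<Union>i\<in>I. B i) \<Longrightarrow> \<theta> q = \<theta>' q) \<Longrightarrow> a p \<theta> = a p \<theta>'"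
  shows "(\<integral>\<theta>. (\<Prod>i\<in>I. h i (\<Sum>p\<in>B i. a p \<theta> * \<theta> p)) \<partial>P) =
    (\<integral>\<theta>. (\<Prod>i\<in>I. \<integral>y. h i y \<partial>centered_normal (\<Sum>p\<in>B i. (a p \<theta>)\<^sup>2)) \<partial>P)"
proof -
  interpret std: prob_space std_normal_distribution
    by (rule prob_space_std_normal)
  interpret P: prob_space P
    unfolding P_def by (intro prob_space_PiM prob_space_std_normal)
  interpret PP: pair_prob_space P P ..
  have coord [measurable]: "(\<lambda>\<theta>. \<theta> p) \<in> borel_measurable P" for p
    unfolding P_def by measurable
  note a [measurable]
  let ?J = "\<Union>i\<in>I. B i"
  let ?T = "\<lambda>(\<theta>, \<omega>) p. if p \<in> ?J then \<omega> p else \<theta> p"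
  define F where "F \<theta> = (\<Prod>i\<in>I. h i (\<Sum>p\<in>B i. a p \<theta> * \<theta> p))" for \<theta>
  have F [measurable]: "F \<in> borel_measurable P"
    unfolding F_def
    by (intro borel_measurable_prod measurable_compose[OF _ h(1)]) measurable
  have F_bound: "\<bar>F \<theta>\<bar> \<le> C ^ card I" for \<theta>
  proof -
    have "\<bar>F \<theta>\<bar> \<le> (\<Prod>i\<in>I. C)"
      unfolding F_def abs_prod using h(2) by (intro prod_mono) auto
    then show ?thesis by simp
  qed
  have T [measurable]: "?T \<in> measurable (P \<Otimes>\<^sub>M P) P"
    unfolding P_def
  proof (rule measurable_PiM_single')
    fix p
    show "(\<lambda>\<omega>. ?T \<omega> p) \<in> measurable (PiM UNIV (\<lambda>_. std_normal_distribution) \<Otimes>\<^sub>M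
        PiM UNIV (\<lambda>_. std_normal_distribution)) std_normal_distribution"
      by (cases "p \<in> ?J") (simp_all add: case_prod_beta)
  qed (auto simp: space_pair_measure space_PiM PiE_iff)
  have "distr (P \<Otimes>\<^sub>M P) P ?T = P"
    unfolding P_def by (rule distr_PiM_resample) (rule prob_space_std_normal)
  then have "(\<integral>\<theta>. F \<theta> \<partial>P) = (\<integral>\<theta>. F \<theta> \<partial>distr (P \<Otimes>\<^sub>M P) P ?T)"
    by simp
  also have "\<dots> = (\<integral>z. F (?T z) \<partial>(P \<Otimes>\<^sub>M P))"
    by (rule integral_distr) measurable
  also have "\<dots> = (\<integral>\<theta>. \<integral>\<omega>. F (?T (\<theta>, \<omega>)) \<partial>P \<partial>P)"
    by (intro PP.integral_fst'[symmetric] PP.integrable_const_bound[where B = "C ^ card I"]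
        AE_I2 measurable_compose[OF T F]) (simp only: real_norm_def F_bound)
  also have "\<dots> = (\<integral>\<theta>. (\<Prod>i\<in>I. \<integral>y. h i y \<partial>centered_normal (\<Sum>p\<in>B i. (a p \<theta>)\<^sup>2)) \<partial>P)"
  proof (rule Bochner_Integration.integral_cong[OF refl])
    fix \<theta>
    let ?X = "\<lambda>i \<omega>. \<Sum>p\<in>B i. a p \<theta> * \<omega> p"
    have coords: "P.indep_vars (\<lambda>_. borel) (\<lambda>p \<omega>. \<omega> p) UNIV"
      unfolding P_def
      using prob_space.indep_vars_compose2[OF _ indep_vars_PiM_coordinates, of UNIV "\<lambda>_. std_normal_distribution" "\<lambda>_ x. x" "\<lambda>_. borel"]
        prob_space_PiM[of UNIV "\<lambda>_. std_normal_distribution"] prob_space_std_normal by auto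
    have "P.indep_vars (\<lambda>i. PiM (B i) (\<lambda>_. borel)) (\<lambda>i \<omega>. restrict \<omega> (B i)) I"
      using P.indep_vars_restrict[OF coords _ B(2)] by simp
    then have "P.indep_vars (\<lambda>_. borel) (\<lambda>i \<omega>. \<Sum>p\<in>B i. a p \<theta> * restrict \<omega> (B i) p) I"
      by (rule P.indep_vars_compose2) measurable
    then have indep: "P.indep_vars (\<lambda>_. borel) ?X I"
      by (rule P.indep_vars_cong[THEN iffD1, rotated -1]) auto
    have law: "distr P borel (?X i) = centered_normal (\<Sum>p\<in>B i. (a p \<theta>)\<^sup>2)" if "i \<in> I" for i
    proof -
      have "P.indep_vars (\<lambda>_. borel) (\<lambda>p \<omega>. \<omega> p) (B i)"
        using coords by (rule P.indep_vars_subset) auto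
      moreover have "distr P borel (\<lambda>\<omega>. \<omega> p) = centered_normal 1" for p
      proof -
        have "distr P borel (\<lambda>\<omega>. \<omega> p) = distr P std_normal_distribution (\<lambda>\<omega>. \<omega> p)"
          by (intro distr_cong) auto
        then show ?thesis
          unfolding P_def centered_normal_1
          using distr_PiM_component[of UNIV "\<lambda>_. std_normal_distribution" p]
          by (simp add: prob_space_std_normal)
      qed
      ultimately show ?thesis
        using P.distr_sum_centered_normal[OF B(1)[OF that], of "\<lambda>p \<omega>. \<omega> p" "\<lambda>_. 1"] by simp
    qed
    have X [measurable]: "?X i \<in> borel_measurable P" for i
      by measurable
    have "F (?T (\<theta>, \<omega>)) = (\<Prod>i\<in>I. h i (?X i \<omega>))" for \<omega>
    proof -
      have "a p (?T (\<theta>, \<omega>)) = a p \<theta>" for p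
        by (rule a_cong) simp
      then show ?thesis
        unfolding F_def by (intro prod.cong refl arg_cong[where f = "h _"] sum.cong) auto
    qed
    then have "(\<integral>\<omega>. F (?T (\<theta>, \<omega>)) \<partial>P) = (\<integral>\<omega>. (\<Prod>i\<in>I. h i (?X i \<omega>)) \<partial>P)"
      by simp
    also have "\<dots> = (\<Prod>i\<in>I. \<integral>\<omega>. h i (?X i \<omega>) \<partial>P)"
      using h
      by (intro P.indep_vars_lebesgue_integral I P.indep_vars_compose2[OF indep]
          P.integrable_const_bound[where B = C] measurable_compose[OF X]) auto
    also have "\<dots> = (\<Prod>i\<in>I. \<integral>y. h i y \<partial>centered_normal (\<Sum>p\<in>B i. (a p \<theta>)\<^sup>2))"
      using h by (intro prod.cong refl) (auto simp: integral_distr simp flip: law)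
    finally show "(\<integral>\<omega>. F (?T (\<theta>, \<omega>)) \<partial>P) = \<dots>" .
  qed
  finally show ?thesis
    by (simp add: F_def)
qed

section \<open>Finite-width networks\<close>

fun param_layer :: "'d param \<Rightarrow> nat" where
  "param_layer (Bias l i) = l"
| "param_layer (InWeight i j) = 1"
| "param_layer (Weight l i j) = l"

fun param_target :: "'d param \<Rightarrow> nat" where
  "param_target (Bias l i) = i"
| "param_target (InWeight i j) = i"
| "param_target (Weight l i j) = i"

text \<open>Relabels the neurons of the output layer only. Since the hidden layers are shared,
  precomposing the parameters with it permutes the outputs. Input weights are affected exactly when
  the input layer is also the output layer.\<close>

fun retarget :: "nat \<Rightarrow> (nat \<Rightarrow> nat) \<Rightarrow> 'd param \<Rightarrow> 'd param" where
  "retarget L \<tau> (Bias l i) = Bias l (if l = L then \<tau> i else i)"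
| "retarget L \<tau> (InWeight i j) = InWeight (if L = 1 then \<tau> i else i) j"
| "retarget L \<tau> (Weight l i j) = Weight l (if l = L then \<tau> i else i) j"

text \<open>A reflection of the Gaussian parameters that negates output \<open>i\<close> and leaves
  all other outputs fixed.\<close>

definition flip_output :: "nat \<Rightarrow> nat \<Rightarrow> ('d param \<Rightarrow> real) \<Rightarrow> 'd param \<Rightarrow> real" where
  "flip_output L i \<theta> p = (if param_layer p = L \<and> param_target p = i then -1 else 1) * \<theta> p"

definition output_params :: "nat \<Rightarrow> nat \<Rightarrow> nat \<Rightarrow> 'd param set" where
  "output_params L n i = insert (Bias L i) (if L = 1 then range (InWeight i) else Weight L i ` {1..n})"

text \<open>An output is linear in the parameters of its last layer, and this is the coefficient of
  \<open>p\<close>. It does not depend on the target neuron of \<open>p\<close>, so all outputs have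
  the same conditional law given the hidden layers.\<close>

definition output_coeff ::
  "(real \<Rightarrow> real) \<Rightarrow> real \<Rightarrow> real \<Rightarrow> nat \<Rightarrow> nat \<Rightarrow> real^'d \<Rightarrow> 'd::finite param \<Rightarrow> ('d param \<Rightarrow> real) \<Rightarrow> real"
where
  "output_coeff \<phi> \<sigma>w \<sigma>b L n x p \<theta> =
     (case p of Bias l i \<Rightarrow> \<sigma>b | InWeight i j \<Rightarrow> \<sigma>w / sqrt (real CARD('d)) * x $ j
      | Weight l i j \<Rightarrow> \<sigma>w / sqrt (real n) * \<phi> (preact \<phi> \<sigma>w \<sigma>b n \<theta> x (L - 1) j))"

lemma preact_cong:
  assumes "\<And>p. param_layer p \<le> l \<Longrightarrow> \<theta> p = \<theta>' p"
  shows "preact \<phi> \<sigma>w \<sigma>b n \<theta> x l i = preact \<phi> \<sigma>w \<sigma>b n \<theta>' x l i"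
  using assms
proof (induction l arbitrary: i rule: induct_nat_012)
  case (ge2 l)
  then have "preact \<phi> \<sigma>w \<sigma>b n \<theta> x (Suc l) j = preact \<phi> \<sigma>w \<sigma>b n \<theta>' x (Suc l) j" for j
    by simp
  then show ?case
    using ge2.prems by simp
qed simp_all

lemma output_layer_cases:
  assumes "1 \<le> L"
  obtains "L = Suc 0" | l where "L = Suc (Suc l)"
  using assms by (cases L rule: nat.exhaust; cases "L - 1" rule: nat.exhaust) auto

lemma net_eq_sum_output_params:
  fixes x :: "real^'d::finite"
  assumes "1 \<le> L"
  shows "net \<phi> \<sigma>w \<sigma>b L n i x \<theta> =
    (\<Sum>p\<in>output_params L n i. output_coeff \<phi> \<sigma>w \<sigma>b L n x p \<theta> * \<theta> p)"
  using assms
proof (cases rule: output_layer_cases)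
  case 1
  have "inj (InWeight i :: 'd \<Rightarrow> 'd param)" by (simp add: inj_def)
  then show ?thesis
    using 1 unfolding net_def output_params_def
    by (subst sum.insert)
      (auto simp: output_coeff_def sum.reindex sum_distrib_left mult_ac)
next
  case (2 l)
  have "inj_on (Weight L i :: nat \<Rightarrow> 'd param) {1..n}" by (simp add: inj_on_def)
  then show ?thesis
    using 2 unfolding net_def output_params_def
    by (subst sum.insert)
      (auto simp: output_coeff_def sum.reindex sum_distrib_left mult_ac)
qed

lemma retarget_id: "param_layer p \<noteq> L \<Longrightarrow> retarget L \<tau> p = p"
  by (cases p) auto

lemma retarget_involution: "(\<And>i. \<tau> (\<tau> i) = i) \<Longrightarrow> retarget L \<tau> (retarget L \<tau> p) = p"
  by (cases p) auto

lemma output_params_retarget: "output_params L n (\<tau> i) = retarget L \<tau> ` output_params L n i"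
  by (force simp: output_params_def)

lemma output_coeff_retarget:
  "output_coeff \<phi> \<sigma>w \<sigma>b L n x (retarget L' \<tau> p) \<theta> = output_coeff \<phi> \<sigma>w \<sigma>b L n x p \<theta>"
  by (cases p) (auto simp: output_coeff_def)

lemma finite_output_params [simp]: "finite (output_params L n i :: 'd::finite param set)"
  by (auto simp: output_params_def)

lemma output_params_layer:
  "p \<in> output_params L n i \<Longrightarrow> param_layer p = L \<and> param_target p = i"
  by (auto simp: output_params_def split: if_splits)

lemma net_retarget:
  assumes "1 \<le> L"
  shows "net \<phi> \<sigma>w \<sigma>b L n i x (\<theta> \<circ> retarget L \<tau>) = net \<phi> \<sigma>w \<sigma>b L n (\<tau> i) x \<theta>"
  using assms
proof (cases rule: output_layer_cases)
  case (2 l)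
  have "preact \<phi> \<sigma>w \<sigma>b n (\<theta> \<circ> retarget L \<tau>) x (Suc l) j = preact \<phi> \<sigma>w \<sigma>b n \<theta> x (Suc l) j" for j
    using 2 by (intro preact_cong) (auto simp: retarget_id)
  then show ?thesis
    using 2 by (simp add: net_def)
qed (simp add: net_def)

lemma net_flip_output:
  assumes "1 \<le> L"
  shows "net \<phi> \<sigma>w \<sigma>b L n j x (flip_output L i \<theta>) =
    (if j = i then -1 else 1) * net \<phi> \<sigma>w \<sigma>b L n j x \<theta>"
  using assms
proof (cases rule: output_layer_cases)
  case 1
  then show ?thesis
    by (auto simp: net_def flip_output_def sum_negf)
next
  case (2 l)
  have "preact \<phi> \<sigma>w \<sigma>b n (flip_output L i \<theta>) x (Suc l) k = preact \<phi> \<sigma>w \<sigma>b n \<theta> x (Suc l) k" for k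
    using 2 by (intro preact_cong) (auto simp: flip_output_def)
  then show ?thesis
    using 2 by (auto simp: net_def flip_output_def sum_negf)
qed

section \<open>Symmetries of the finite-width neural tangent kernel\<close>

lemma partial_deriv_comp_involution:
  assumes "\<And>p. \<pi> (\<pi> p) = p"
  shows "partial_deriv (\<lambda>\<theta>. F (\<theta> \<circ> \<pi>)) p \<theta> = partial_deriv F (\<pi> p) (\<theta> \<circ> \<pi>)"
proof -
  have "\<theta>(p := t) \<circ> \<pi> = (\<theta> \<circ> \<pi>)(\<pi> p := t)" for t
    using assms by (auto simp: fun_eq_iff)
  then show ?thesis
    unfolding partial_deriv_def by (simp add: assms)
qed

text \<open>Along coordinate \<open>p\<close>, the function at the reflected point is the one at the
  original point with its argument multiplied by \<open>s p\<close> and its value by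
  \<open>e\<close>. This relation is its own inverse, so differentiability carries over in both
  directions and the default value 0 is taken on both sides at once.\<close>

lemma partial_deriv_sign_change:
  fixes \<theta> :: "'p \<Rightarrow> real"
  assumes s: "s p * s p = 1" and e: "e * e = 1"
    and F: "\<And>\<theta>. F (\<lambda>q. s q * \<theta> q) = e * F \<theta>"
  shows "partial_deriv F p (\<lambda>q. s q * \<theta> q) = e * s p * partial_deriv F p \<theta>"
proof -
  define f where "f t = F (\<theta>(p := t))" for t
  define g where "g t = F ((\<lambda>q. s q * \<theta> q)(p := t))" for t
  have g: "g = (\<lambda>t. e * f (s p * t))"
  proof
    fix t
    have "(\<lambda>q. s q * \<theta> q)(p := t) = (\<lambda>q. s q * (\<theta>(p := s p * t)) q)"
      using s by (auto simp: fun_eq_iff mult.assoc[symmetric])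
    then show "g t = e * f (s p * t)"
      unfolding g_def f_def by (simp only: F)
  qed
  have f: "f = (\<lambda>t. e * g (s p * t))"
    unfolding g using s e by (simp add: mult.assoc[symmetric])
  have chain: "((\<lambda>t. e * k (s p * t)) has_real_derivative e * s p * D) (at (s p * a))"
    if "(k has_real_derivative D) (at a)" for k D and a :: real
  proof -
    have "(k has_real_derivative D) (at (s p * (s p * a)))"
      using that s by (simp add: mult.assoc[symmetric])
    then have "((\<lambda>t. k (s p * t)) has_real_derivative D * s p) (at (s p * a))"
      by (rule DERIV_chain2) (auto intro!: derivative_eq_intros)
    then show ?thesis
      by (auto intro!: derivative_eq_intros)
  qed
  show ?thesis
  proof (cases "f differentiable at (\<theta> p)")
    case True
    then have "(f has_real_derivative deriv f (\<theta> p)) (at (\<theta> p))"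
      by (simp add: DERIV_deriv_iff_real_differentiable)
    then have *: "(g has_real_derivative e * s p * deriv f (\<theta> p)) (at (s p * \<theta> p))"
      unfolding g by (rule chain)
    then have "g differentiable at (s p * \<theta> p)"
      by (auto simp: real_differentiable_def)
    then show ?thesis
      using True DERIV_imp_deriv[OF *] unfolding partial_deriv_def f_def g_def by simp
  next
    case False
    have "\<not> g differentiable at (s p * \<theta> p)"
    proof
      assume "g differentiable at (s p * \<theta> p)"
      then obtain D where "(g has_real_derivative D) (at (s p * \<theta> p))"
        by (auto simp: real_differentiable_def)
      then have "(f has_real_derivative e * s p * D) (at (s p * (s p * \<theta> p)))"
        by (subst f) (rule chain)
      then show False
        using False s by (auto simp: real_differentiable_def mult.assoc[symmetric])
    qed
    then show ?thesis
      using False unfolding partial_deriv_def f_def g_def by simp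
  qed
qed

lemma partial_deriv_unused:
  assumes "\<And>t. F (\<theta>(p := t)) = F \<theta>"
  shows "partial_deriv F p \<theta> = 0"
  unfolding partial_deriv_def by (simp add: assms)

text \<open>For every parameter, in whichever layer, the derivatives of outputs \<open>i\<close> and
  \<open>j\<close> pick up the factors - s p and s p. Since (s p)^2 = 1, each summand changes its
  sign.\<close>

lemma empirical_ntk_flip_output:
  assumes "1 \<le> L" "i \<noteq> j"
  shows "empirical_ntk \<phi> \<sigma>w \<sigma>b L K n i j x x' (flip_output L i \<theta>) =
    - empirical_ntk \<phi> \<sigma>w \<sigma>b L K n i j x x' \<theta>"
proof -
  define s :: "'a param \<Rightarrow> real"
    where "s p = (if param_layer p = L \<and> param_target p = i then -1 else 1)" for p
  have s: "s p * s p = 1" for p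
    by (simp add: s_def)
  have flip: "flip_output L i = (\<lambda>\<theta> p. s p * \<theta> p)"
    by (intro ext) (simp add: flip_output_def s_def)
  have "partial_deriv (net \<phi> \<sigma>w \<sigma>b L n i x) p (flip_output L i \<theta>) =
      -1 * s p * partial_deriv (net \<phi> \<sigma>w \<sigma>b L n i x) p \<theta>" for p
    unfolding flip using net_flip_output[OF assms(1), of \<phi> \<sigma>w \<sigma>b n i x i]
    by (intro partial_deriv_sign_change s) (simp_all add: flip)
  moreover have "partial_deriv (net \<phi> \<sigma>w \<sigma>b L n j x') p (flip_output L i \<theta>) =
      1 * s p * partial_deriv (net \<phi> \<sigma>w \<sigma>b L n j x') p \<theta>" for p
    unfolding flip using net_flip_output[OF assms(1), of \<phi> \<sigma>w \<sigma>b n j x' i] assms(2)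
    by (intro partial_deriv_sign_change s) (simp_all add: flip)
  moreover have "(-1 * s p * a) * (1 * s p * b) = - (a * b)" for p a b
  proof -
    have "(-1 * s p * a) * (1 * s p * b) = - (s p * s p * (a * b))"
      by (simp add: mult_ac)
    then show ?thesis by (simp add: s)
  qed
  ultimately show ?thesis
    unfolding empirical_ntk_def sum_negf[symmetric]
    by (intro sum.cong refl) (simp only:)
qed

lemma net_params_iff:
  "Bias l i \<in> net_params L n K \<longleftrightarrow> l \<in> {1..L} \<and> i \<in> {1..layer_width L n K l}"
  "InWeight i k \<in> net_params L n K \<longleftrightarrow> i \<in> {1..layer_width L n K 1}"
  "Weight l i j \<in> net_params L n K \<longleftrightarrow> l \<in> {2..L} \<and> i \<in> {1..layer_width L n K l} \<and> j \<in> {1..n}"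
  unfolding net_params_def by simp_all

lemma net_params_retarget:
  assumes \<tau>: "\<And>i. \<tau> (\<tau> i) = i" "\<tau> ` {1..K} = {1..K}"
  shows "retarget L \<tau> ` net_params L n K = (net_params L n K :: 'd param set)"
proof -
  have \<tau>_in: "\<tau> i \<in> {1..K}" if "i \<in> {1..K}" for i
    using that \<tau>(2) by blast
  have "retarget L \<tau> p \<in> net_params L n K" if "p \<in> net_params L n K" for p :: "'d param"
    using that \<tau>_in by (cases p) (auto simp: net_params_iff layer_width_def split: if_splits)
  then have sub: "retarget L \<tau> ` net_params L n K \<subseteq> (net_params L n K :: 'd param set)"
    by blast
  have "p \<in> retarget L \<tau> ` net_params L n K" if "p \<in> net_params L n K" for p :: "'d param"
    using sub that retarget_involution[of \<tau> L p, OF \<tau>(1)] by (metis image_eqI image_subset_iff)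
  then show ?thesis
    using sub by blast
qed

text \<open>The relabelling maps the parameter set onto itself, so it only reorders the
  summands.\<close>

lemma empirical_ntk_retarget:
  fixes x x' :: "real^'d::finite"
  assumes L: "1 \<le> L" and \<tau>: "\<And>i. \<tau> (\<tau> i) = i" "\<tau> ` {1..K} = {1..K}"
  shows "empirical_ntk \<phi> \<sigma>w \<sigma>b L K n i j x x' (\<theta> \<circ> retarget L \<tau>) =
    empirical_ntk \<phi> \<sigma>w \<sigma>b L K n (\<tau> i) (\<tau> j) x x' \<theta>"
proof -
  let ?r = "retarget L \<tau>"
  have inv: "?r (?r p) = p" for p :: "'d param"
    by (rule retarget_involution) (rule \<tau>)
  have pd: "partial_deriv (net \<phi> \<sigma>w \<sigma>b L n (\<tau> k) y) p \<theta> =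
      partial_deriv (net \<phi> \<sigma>w \<sigma>b L n k y) (?r p) (\<theta> \<circ> ?r)" for k p and y :: "real^'d"
    using partial_deriv_comp_involution[where \<pi> = ?r and F = "net \<phi> \<sigma>w \<sigma>b L n k y", OF inv]
    by (simp add: net_retarget[OF L])
  have "inj_on ?r (net_params L n K :: 'd param set)"
    by (rule inj_onI) (metis inv)
  then show ?thesis
    unfolding empirical_ntk_def pd
    by (subst net_params_retarget[OF \<tau>, of L n, symmetric]) (simp add: sum.reindex inv)
qed

lemma finite_net_params: "finite (net_params L n K :: 'd::finite param set)"
proof -
  have "(net_params L n K :: 'd param set) =
      (\<Union>l\<in>{1..L}. Bias l ` {1..layer_width L n K l}) \<union>
      (\<Union>i\<in>{1..layer_width L n K 1}. range (InWeight i)) \<union>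
      (\<Union>l\<in>{2..L}. \<Union>i\<in>{1..layer_width L n K l}. Weight l i ` {1..n})"
    unfolding net_params_def
  proof (intro arg_cong2[where f = "(\<union>)"])
    show "{Bias l i | l i. l \<in> {1..L} \<and> i \<in> {1..layer_width L n K l}} =
        (\<Union>l\<in>{1..L}. Bias l ` {1..layer_width L n K l} :: 'd param set)"
      by fast
    show "{InWeight i j | i j. i \<in> {1..layer_width L n K 1}} =
        (\<Union>i\<in>{1..layer_width L n K 1}. range (InWeight i) :: 'd param set)"
      by fast
    show "{Weight l i j | l i j. l \<in> {2..L} \<and> i \<in> {1..layer_width L n K l} \<and> j \<in> {1..n}} =
        (\<Union>l\<in>{2..L}. \<Union>i\<in>{1..layer_width L n K l}. Weight l i ` {1..n} :: 'd param set)"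
      by fast
  qed
  then show ?thesis
    by simp
qed

text \<open>The parameters that further outputs add belong to the output layer and have a target
  other than 1. Output 1 does not read them, so their partial derivatives vanish.\<close>

lemma empirical_ntk_first_output:
  fixes x x' :: "real^'d::finite"
  assumes "1 \<le> L" "1 \<le> K"
  shows "empirical_ntk \<phi> \<sigma>w \<sigma>b L K n 1 1 x x' \<theta> = empirical_ntk \<phi> \<sigma>w \<sigma>b L 1 n 1 1 x x' \<theta>"
  unfolding empirical_ntk_def
proof (rule sum.mono_neutral_right[OF finite_net_params])
  show "net_params L n 1 \<subseteq> (net_params L n K :: 'd param set)"
  proof
    fix p :: "'d param"
    assume "p \<in> net_params L n 1"
    then show "p \<in> net_params L n K"
      using assms by (cases p) (simp_all add: net_params_iff layer_width_def split: if_splits)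
  qed
  have "partial_deriv (net \<phi> \<sigma>w \<sigma>b L n 1 y) p \<theta> = 0"
    if "p \<in> net_params L n K - net_params L n 1" for p and y :: "real^'d"
  proof (rule partial_deriv_unused)
    fix t
    have "param_layer p = L \<and> param_target p \<noteq> 1"
    proof (cases p)
      case (Bias l i)
      with that show ?thesis
        by (cases "l = L") (auto simp: net_params_iff layer_width_def)
    next
      case (InWeight i k)
      with that show ?thesis
        by (cases "L = 1") (auto simp: net_params_iff layer_width_def)
    next
      case (Weight l i k)
      with that show ?thesis
        by (cases "l = L") (auto simp: net_params_iff layer_width_def)
    qed
    then have p: "param_layer p = L" "param_target p \<noteq> 1"
      by simp_all
    show "net \<phi> \<sigma>w \<sigma>b L n 1 y (\<theta>(p := t)) = net \<phi> \<sigma>w \<sigma>b L n 1 y \<theta>"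
      using assms(1)
    proof (cases rule: output_layer_cases)
      case 1
      then show ?thesis
        using p by (cases p) (auto simp: net_def)
    next
      case (2 l)
      have "preact \<phi> \<sigma>w \<sigma>b n (\<theta>(p := t)) y (Suc l) k = preact \<phi> \<sigma>w \<sigma>b n \<theta> y (Suc l) k" for k
        using 2 p by (intro preact_cong) auto
      then show ?thesis
        using 2 p by (cases p) (auto simp: net_def)
    qed
  qed
  then show "\<forall>p\<in>net_params L n K - net_params L n 1.
      partial_deriv (net \<phi> \<sigma>w \<sigma>b L n 1 x) p \<theta> * partial_deriv (net \<phi> \<sigma>w \<sigma>b L n 1 x') p \<theta> = 0"
    by (metis mult_zero_left)
qed

section \<open>Limits in probability of the neural tangent kernel\<close>

lemma converges_in_prob_const_compose:
  assumes X: "converges_in_prob_const P X c"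
    and T: "T \<in> measurable P P" "distr P P T = P"
  shows "converges_in_prob_const P (\<lambda>n \<omega>. X n (T \<omega>)) c"
proof -
  have X_measurable [measurable]: "X n \<in> borel_measurable P" for n
    using X by (simp add: converges_in_prob_const_def)
  have "measure P {\<omega> \<in> space P. \<bar>X n (T \<omega>) - c\<bar> > e} = measure P {\<omega> \<in> space P. \<bar>X n \<omega> - c\<bar> > e}" for n e
  proof -
    have "measure P {\<omega> \<in> space P. \<bar>X n \<omega> - c\<bar> > e} = measure (distr P P T) {\<omega> \<in> space P. \<bar>X n \<omega> - c\<bar> > e}"
      by (simp add: T(2))
    also have "\<dots> = measure P (T -` {\<omega> \<in> space P. \<bar>X n \<omega> - c\<bar> > e} \<inter> space P)"
      by (rule measure_distr[OF T(1)]) measurable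
    also have "T -` {\<omega> \<in> space P. \<bar>X n \<omega> - c\<bar> > e} \<inter> space P = {\<omega> \<in> space P. \<bar>X n (T \<omega>) - c\<bar> > e}"
      using measurable_space[OF T(1)] by auto
    finally show ?thesis ..
  qed
  then show ?thesis
    using X measurable_compose[OF T(1) X_measurable] by (simp add: converges_in_prob_const_def)
qed

lemma converges_in_prob_const_uminus:
  "converges_in_prob_const P X c \<Longrightarrow> converges_in_prob_const P (\<lambda>n \<omega>. - X n \<omega>) (- c)"
  by (simp add: converges_in_prob_const_def abs_minus_commute)

lemma (in prob_space) converges_in_prob_const_unique:
  assumes c: "converges_in_prob_const M X c" and d: "converges_in_prob_const M X d"
  shows "c = d"
proof (rule ccontr)
  assume "c \<noteq> d"
  \<comment> \<open>With a third of the distance no value is within \<open>e\<close> of both limits: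
    the two deviation events cover the space, so their probabilities cannot both tend to 0.\<close>
  define e where "e = \<bar>c - d\<bar> / 3"
  have "e > 0" using \<open>c \<noteq> d\<close> by (simp add: e_def)
  have [measurable]: "X n \<in> borel_measurable M" for n
    using c by (simp add: converges_in_prob_const_def)
  let ?D = "\<lambda>a n. {\<omega> \<in> space M. \<bar>X n \<omega> - a\<bar> > e}"
  have "(\<lambda>n. prob (?D c n) + prob (?D d n)) \<longlonglongrightarrow> 0 + 0"
    using c d \<open>e > 0\<close> by (intro tendsto_add) (auto simp: converges_in_prob_const_def)
  moreover have "1 \<le> prob (?D c n) + prob (?D d n)" for n
  proof -
    have "\<omega> \<in> ?D c n \<union> ?D d n" if "\<omega> \<in> space M" for \<omega>
    proof -
      have "3 * e \<le> \<bar>X n \<omega> - c\<bar> + \<bar>X n \<omega> - d\<bar>"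
        by (simp add: e_def)
      then have "\<bar>X n \<omega> - c\<bar> > e \<or> \<bar>X n \<omega> - d\<bar> > e"
        using \<open>e > 0\<close> by linarith
      then show ?thesis
        using that by blast
    qed
    then have "1 = prob (?D c n \<union> ?D d n)"
      by (intro prob_eq_1[THEN iffD2, symmetric]) auto
    also have "\<dots> \<le> prob (?D c n) + prob (?D d n)"
      by (intro measure_Un_le) auto
    finally show ?thesis .
  qed
  ultimately have "(1::real) \<le> 0 + 0"
    by (intro LIMSEQ_le_const) auto
  then show False by simp
qed

lemma prob_space_init_measure: "prob_space init_measure"
  unfolding init_measure_def by (intro prob_space_PiM prob_space_std_normal)

lemma init_measure_retarget:
  assumes "\<And>i. \<tau> (\<tau> i) = i"
  shows "(\<lambda>\<theta>. \<theta> \<circ> retarget L \<tau>) \<in> measurable init_measure init_measure"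
    "distr init_measure init_measure (\<lambda>\<theta>. \<theta> \<circ> retarget L \<tau>) = init_measure"
proof -
  have "inj (retarget L \<tau>)"
    using retarget_involution[OF assms] by (rule inj_on_inverseI)
  then show "distr init_measure init_measure (\<lambda>\<theta>. \<theta> \<circ> retarget L \<tau>) = init_measure"
    using distr_PiM_reindex[of UNIV "\<lambda>_. std_normal_distribution" "retarget L \<tau>" UNIV,
        OF prob_space_std_normal]
    by (simp add: init_measure_def comp_def restrict_UNIV)
  show "(\<lambda>\<theta>. \<theta> \<circ> retarget L \<tau>) \<in> measurable init_measure init_measure"
    unfolding init_measure_def comp_def
    by (rule measurable_PiM_single') (auto simp: space_PiM)
qed

lemma init_measure_flip_output:
  "flip_output L i \<in> measurable init_measure init_measure"
  "distr init_measure init_measure (flip_output L i) = init_measure"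
proof -
  have neg: "distr std_normal_distribution std_normal_distribution (\<lambda>y. c * y) = std_normal_distribution"
    if "c\<^sup>2 = 1" for c :: real
  proof -
    interpret prob_space std_normal_distribution
      by (rule prob_space_std_normal)
    \<comment> \<open>The law of c * y comes from the sum lemma over a one-point index set, where
      \<open>c\<close> enters only through its square.\<close>
    have "distr std_normal_distribution borel (\<lambda>y. \<Sum>i\<in>{()}. c * y) = centered_normal (\<Sum>i\<in>{()}. c\<^sup>2 * 1)"
    proof (rule distr_sum_centered_normal)
      show "indep_vars (\<lambda>_. borel) (\<lambda>_ y. y) {()}"
        unfolding indep_vars_def2 indep_sets_def
      proof (intro conjI ballI allI impI)
        fix J A
        assume "J \<subseteq> {()}" "J \<noteq> {}"
        then have "J = {()}" by auto
        then show "prob (\<Inter>j\<in>J. A j) = (\<Prod>j\<in>J. prob (A j))" by simp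
      qed auto
      show "distr std_normal_distribution borel (\<lambda>y. y) = centered_normal 1"
        unfolding centered_normal_1 by (rule distr_id2) simp
    qed auto
    moreover have "distr std_normal_distribution std_normal_distribution (\<lambda>y. c * y) =
        distr std_normal_distribution borel (\<lambda>y. c * y)"
      by (intro distr_cong) auto
    ultimately show ?thesis
      using that by (simp add: centered_normal_1)
  qed
  have flip: "flip_output L i =
      (\<lambda>\<theta> p. (if param_layer p = L \<and> param_target p = i then -1 else 1) * \<theta> p)"
    by (intro ext) (simp add: flip_output_def)
  show "distr init_measure init_measure (flip_output L i) = init_measure"
    unfolding init_measure_def flip
    by (rule distr_PiM_componentwise) (auto intro!: prob_space_std_normal neg neg[of "-1", simplified])
  show "flip_output L i \<in> measurable init_measure init_measure"
    unfolding init_measure_def flip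
    by (rule measurable_PiM_single') (auto simp: space_PiM)
qed

theorem ntk_multi_output:
  assumes L: "1 \<le> L" and ntk: "is_ntk \<phi> \<sigma>w \<sigma>b L 1 (\<lambda>_ _. \<Theta>)"
    and ntk_K: "is_ntk \<phi> \<sigma>w \<sigma>b L K \<Theta>K" and i: "i \<in> {1..K}" and j: "j \<in> {1..K}"
  shows "\<Theta>K i j x x' = (if i = j then \<Theta> x x' else 0)"
proof (cases "i = j")
  case True
  interpret prob_space init_measure by (rule prob_space_init_measure)
  \<comment> \<open>Exchanging outputs 1 and \<open>i\<close> moves the diagonal block to output 1,
    where the kernel of the \<open>K\<close>-output network coincides with the scalar one at every
    width.\<close>
  let ?\<tau> = "Transposition.transpose 1 i"
  have "1 \<le> K" using i by simp
  have \<tau>: "?\<tau> (?\<tau> k) = k" for k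
    by simp
  have \<tau>_image: "?\<tau> ` {1..K} = {1..K}"
  proof (rule transpose_image_eq)
    have "1 \<in> {1..K}" using i by simp
    then show "1 \<in> {1..K} \<longleftrightarrow> i \<in> {1..K}" using i by (simp only:)
  qed
  have conv: "converges_in_prob_const init_measure
      (\<lambda>n. empirical_ntk \<phi> \<sigma>w \<sigma>b L K n i i x x') (\<Theta>K i i x x')"
    using ntk_K i unfolding is_ntk_def by blast
  have "converges_in_prob_const init_measure
      (\<lambda>n \<theta>. empirical_ntk \<phi> \<sigma>w \<sigma>b L K n i i x x' (\<theta> \<circ> retarget L ?\<tau>)) (\<Theta>K i i x x')"
    by (rule converges_in_prob_const_compose[OF conv init_measure_retarget[OF \<tau>]])
  then have "converges_in_prob_const init_measure
      (\<lambda>n. empirical_ntk \<phi> \<sigma>w \<sigma>b L 1 n 1 1 x x') (\<Theta>K i i x x')"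
    by (simp add: empirical_ntk_retarget[OF L \<tau> \<tau>_image] empirical_ntk_first_output[OF L \<open>1 \<le> K\<close>]
        del: One_nat_def)
  moreover have "converges_in_prob_const init_measure
      (\<lambda>n. empirical_ntk \<phi> \<sigma>w \<sigma>b L 1 n 1 1 x x') (\<Theta> x x')"
    using ntk by (simp add: is_ntk_def)
  ultimately have "\<Theta>K i i x x' = \<Theta> x x'"
    by (rule converges_in_prob_const_unique)
  then show ?thesis
    using True by simp
next
  case False
  interpret prob_space init_measure by (rule prob_space_init_measure)
  have conv: "converges_in_prob_const init_measure
      (\<lambda>n. empirical_ntk \<phi> \<sigma>w \<sigma>b L K n i j x x') (\<Theta>K i j x x')"
    using ntk_K i j by (simp add: is_ntk_def)
  \<comment> \<open>The flip preserves the initial law, so the flipped kernels have the same limit;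
    but they are the negatives of the original ones.\<close>
  have "converges_in_prob_const init_measure
      (\<lambda>n \<theta>. empirical_ntk \<phi> \<sigma>w \<sigma>b L K n i j x x' (flip_output L i \<theta>)) (\<Theta>K i j x x')"
    by (rule converges_in_prob_const_compose[OF conv init_measure_flip_output])
  then have "converges_in_prob_const init_measure
      (\<lambda>n \<theta>. - empirical_ntk \<phi> \<sigma>w \<sigma>b L K n i j x x' \<theta>) (\<Theta>K i j x x')"
    by (simp add: empirical_ntk_flip_output[OF L False])
  then have "\<Theta>K i j x x' = - \<Theta>K i j x x'"
    by (rule converges_in_prob_const_unique) (rule converges_in_prob_const_uminus[OF conv])
  then show ?thesis
    using False by simp
qed

lemma ntk_symmetric:
  assumes "is_ntk \<phi> \<sigma>w \<sigma>b L 1 (\<lambda>_ _. \<Theta>)"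
  shows "\<Theta> x x' = \<Theta> x' x"
proof -
  interpret prob_space init_measure by (rule prob_space_init_measure)
  have "empirical_ntk \<phi> \<sigma>w \<sigma>b L 1 n 1 1 x x' = empirical_ntk \<phi> \<sigma>w \<sigma>b L 1 n 1 1 x' x" for n
    by (intro ext) (simp add: empirical_ntk_def mult.commute)
  then show ?thesis
    using assms by (intro converges_in_prob_const_unique) (auto simp: is_ntk_def)
qed

lemma nngp_kernel_symmetric: "is_nngp_kernel \<phi> \<sigma>w \<sigma>b L \<kappa> \<Longrightarrow> \<kappa> x x' = \<kappa> x' x"
  unfolding is_nngp_kernel_def
  by (rule LIMSEQ_unique[where X = "\<lambda>n. \<integral>\<theta>. net \<phi> \<sigma>w \<sigma>b L n 1 x \<theta> * net \<phi> \<sigma>w \<sigma>b L n 1 x' \<theta> \<partial>init_measure"])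
    (blast, subst mult.commute, blast)

section \<open>The outputs conditionally on the hidden layers\<close>

lemma preact_measurable:
  assumes [measurable]: "\<phi> \<in> borel_measurable borel"
  shows "(\<lambda>\<theta>. preact \<phi> \<sigma>w \<sigma>b n \<theta> x l i) \<in> borel_measurable init_measure"
proof (induction l arbitrary: i rule: induct_nat_012)
  case 1
  show ?case
    unfolding init_measure_def by simp
next
  case (ge2 l)
  have [measurable]: "(\<lambda>\<theta>. \<theta> p) \<in> borel_measurable init_measure" for p :: "'a param"
    unfolding init_measure_def by measurable
  note ge2(2) [measurable]
  show ?case
    unfolding preact.simps by measurable
qed simp

definition output_variance ::
  "(real \<Rightarrow> real) \<Rightarrow> real \<Rightarrow> real \<Rightarrow> nat \<Rightarrow> nat \<Rightarrow> (real^'d) set \<Rightarrow> (real^'d \<Rightarrow> real)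
     \<Rightarrow> ('d::finite param \<Rightarrow> real) \<Rightarrow> real"
where
  "output_variance \<phi> \<sigma>w \<sigma>b L n S c \<theta> =
     (\<Sum>p\<in>output_params L n 1. (\<Sum>x\<in>S. c x * output_coeff \<phi> \<sigma>w \<sigma>b L n x p \<theta>)\<^sup>2)"

lemma output_coeff_measurable:
  assumes "\<phi> \<in> borel_measurable borel"
  shows "output_coeff \<phi> \<sigma>w \<sigma>b L n x p \<in> borel_measurable init_measure"
proof (cases p)
  case (Weight l i j)
  have [measurable]: "(\<lambda>\<theta>. preact \<phi> \<sigma>w \<sigma>b n \<theta> x (L - 1) j) \<in> borel_measurable init_measure"
    by (rule preact_measurable) fact
  note assms [measurable]
  show ?thesis
    unfolding output_coeff_def Weight param.case by measurable
qed (simp_all add: output_coeff_def[abs_def])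

lemma output_variance_measurable:
  assumes [measurable]: "\<phi> \<in> borel_measurable borel"
  shows "output_variance \<phi> \<sigma>w \<sigma>b L n S c \<in> borel_measurable init_measure"
  unfolding output_variance_def[abs_def]
  by (intro borel_measurable_sum borel_measurable_power borel_measurable_times
      borel_measurable_const output_coeff_measurable assms)

text \<open>
  Given the hidden layers, the outputs are i.i.d. centered Gaussian; the common conditional variance
  of a linear combination of the values of one output is \<open>output_variance\<close>.
\<close>

lemma integral_prod_net:
  fixes S :: "(real^'d::finite) set" and h :: "nat \<Rightarrow> real \<Rightarrow> real"
  assumes L: "1 \<le> L" and \<phi>: "\<phi> \<in> borel_measurable borel" and I: "finite I"
    and h: "\<And>i. i \<in> I \<Longrightarrow> h i \<in> borel_measurable borel" "\<And>i y. i \<in> I \<Longrightarrow> \<bar>h i y\<bar> \<le> C"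
  shows "(\<integral>\<theta>. (\<Prod>i\<in>I. h i (\<Sum>x\<in>S. c x * net \<phi> \<sigma>w \<sigma>b L n i x \<theta>)) \<partial>init_measure) =
    (\<integral>\<theta>. (\<Prod>i\<in>I. \<integral>y. h i y \<partial>centered_normal (output_variance \<phi> \<sigma>w \<sigma>b L n S c \<theta>)) \<partial>init_measure)"
proof -
  let ?a = "\<lambda>p \<theta>. \<Sum>x\<in>S. c x * output_coeff \<phi> \<sigma>w \<sigma>b L n x p \<theta>"
  have lin: "(\<Sum>x\<in>S. c x * net \<phi> \<sigma>w \<sigma>b L n i x \<theta>) = (\<Sum>p\<in>output_params L n i. ?a p \<theta> * \<theta> p)" for i \<theta>
    unfolding net_eq_sum_output_params[OF L] sum_distrib_left sum_distrib_right mult.assoc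
    by (rule sum.swap)
  \<comment> \<open>Exchanging outputs 1 and \<open>i\<close> carries one block of output parameters
    to the other and keeps the coefficients, so the variance is the same for every output.\<close>
  have var: "(\<Sum>p\<in>output_params L n i. (?a p \<theta>)\<^sup>2) = output_variance \<phi> \<sigma>w \<sigma>b L n S c \<theta>" for i \<theta>
  proof -
    let ?\<tau> = "Transposition.transpose 1 i"
    have inj: "inj_on (retarget L ?\<tau>) (output_params L n 1 :: 'd param set)"
      by (rule inj_on_inverseI, rule retarget_involution) simp
    have "output_params L n i = retarget L ?\<tau> ` (output_params L n 1 :: 'd param set)"
      using output_params_retarget[of L n ?\<tau> 1] by simp
    then show ?thesis
      by (simp only: sum.reindex[OF inj] comp_def output_coeff_retarget output_variance_def)
  qed
  have "(\<integral>\<theta>. (\<Prod>i\<in>I. h i (\<Sum>p\<in>output_params L n i. ?a p \<theta> * \<theta> p)) \<partial>init_measure) =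
    (\<integral>\<theta>. (\<Prod>i\<in>I. \<integral>y. h i y \<partial>centered_normal (\<Sum>p\<in>output_params L n i. (?a p \<theta>)\<^sup>2)) \<partial>init_measure)"
    unfolding init_measure_def
  proof (rule integral_prod_std_normal_blocks[OF I _ _ h])
    show "disjoint_family_on (output_params L n) I"
      unfolding disjoint_family_on_def using output_params_layer by blast
    show "?a p \<in> borel_measurable (\<Pi>\<^sub>M p\<in>UNIV. std_normal_distribution)" for p
      unfolding init_measure_def[symmetric]
      by (intro borel_measurable_sum borel_measurable_times borel_measurable_const
          output_coeff_measurable \<phi>)
    show "?a p \<theta> = ?a p \<theta>'"
      if eq: "\<And>q. q \<notin> (\<Union>i\<in>I. output_params L n i) \<Longrightarrow> \<theta> q = \<theta>' q" for p \<theta> \<theta>'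
    proof -
      \<comment> \<open>The coefficients read layers up to L - 1, whereas all blocks lie in layer L.
        For L = 1 the lower layer is the dummy layer 0.\<close>
      have "preact \<phi> \<sigma>w \<sigma>b n \<theta> x (L - 1) j = preact \<phi> \<sigma>w \<sigma>b n \<theta>' x (L - 1) j" for x j
      proof (intro preact_cong eq)
        fix q :: "'d param"
        assume "param_layer q \<le> L - 1"
        then have "param_layer q \<noteq> L" using L by simp
        then show "q \<notin> (\<Union>i\<in>I. output_params L n i)"
          using output_params_layer by blast
      qed
      then show ?thesis
        unfolding output_coeff_def by (simp only:)
    qed
  qed simp
  then show ?thesis
    unfolding lin var .
qed

section \<open>The infinite-width limit at initialization\<close>

text \<open>
  Convergence of two Laplace transforms at a point mass already gives convergence of
  \<open>exp (- Z n)\<close> in mean square, hence of \<open>Z n\<close> in probability.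
\<close>

lemma (in prob_space) expectation_tendsto_of_laplace:
  fixes Z :: "nat \<Rightarrow> 'a \<Rightarrow> real" and \<Psi> :: "real \<Rightarrow> real"
  assumes Z [measurable]: "\<And>n. Z n \<in> borel_measurable M" and Z_nonneg: "\<And>n \<omega>. 0 \<le> Z n \<omega>"
    and lim1: "(\<lambda>n. expectation (\<lambda>\<omega>. exp (- Z n \<omega>))) \<longlonglongrightarrow> exp (- v)"
    and lim2: "(\<lambda>n. expectation (\<lambda>\<omega>. exp (- (2 * Z n \<omega>)))) \<longlonglongrightarrow> exp (- (2 * v))"
    and \<Psi> [measurable]: "\<Psi> \<in> borel_measurable borel" and bounded: "\<And>z. \<bar>\<Psi> z\<bar> \<le> C"
    and cont: "isCont \<Psi> v"
  shows "(\<lambda>n. expectation (\<lambda>\<omega>. \<Psi> (Z n \<omega>))) \<longlonglongrightarrow> \<Psi> v"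
proof -
  \<comment> \<open>The expectation of \<open>W n\<close> expands into the two given Laplace
    transforms, and the limits cancel: exp (-2v) - 2 exp (-2v) + exp (-2v) = 0.\<close>
  define W where "W n \<omega> = (exp (- Z n \<omega>) - exp (- v))\<^sup>2" for n \<omega>
  have [measurable]: "W n \<in> borel_measurable M" for n
    unfolding W_def by measurable
  have int1: "integrable M (\<lambda>\<omega>. exp (- Z n \<omega>))" and int2: "integrable M (\<lambda>\<omega>. exp (- (2 * Z n \<omega>)))" for n
    using Z_nonneg by (auto intro!: integrable_const_bound[where B = 1])
  have W_expand: "W n = (\<lambda>\<omega>. exp (- (2 * Z n \<omega>)) - 2 * exp (- v) * exp (- Z n \<omega>) + exp (- (2 * v)))" for n
    by (auto simp: W_def fun_eq_iff power2_diff simp flip: exp_double)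
  have int_W: "integrable M (W n)" for n
    unfolding W_expand using int1 int2 by (intro Bochner_Integration.integrable_add Bochner_Integration.integrable_diff) auto
  have "expectation (W n) = expectation (\<lambda>\<omega>. exp (- (2 * Z n \<omega>))) -
      2 * exp (- v) * expectation (\<lambda>\<omega>. exp (- Z n \<omega>)) + exp (- (2 * v))" for n
    unfolding W_expand using int1[of n] int2[of n] by (simp add: prob_space)
  moreover have "(\<lambda>n. expectation (\<lambda>\<omega>. exp (- (2 * Z n \<omega>))) -
      2 * exp (- v) * expectation (\<lambda>\<omega>. exp (- Z n \<omega>)) + exp (- (2 * v))) \<longlonglongrightarrow>
      exp (- (2 * v)) - 2 * exp (- v) * exp (- v) + exp (- (2 * v))"
    by (intro tendsto_intros lim1 lim2)
  moreover have "exp (- (2 * v)) - 2 * exp (- v) * exp (- v) + exp (- (2 * v)) = 0"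
  proof -
    have "exp (- v) * exp (- v) = exp (- (2 * v))"
      by (simp flip: exp_add)
    then show ?thesis
      unfolding mult.assoc by simp
  qed
  ultimately have W_lim: "(\<lambda>n. expectation (W n)) \<longlonglongrightarrow> 0"
    by (simp only:)
  have "0 \<le> C"
    using bounded[of 0] by simp
  show ?thesis
  proof (rule LIMSEQ_I)
    fix e :: real assume "0 < e"
    obtain d where d: "0 < d" "\<And>z. \<bar>z - v\<bar> < d \<Longrightarrow> \<bar>\<Psi> z - \<Psi> v\<bar> < e / 2"
      using cont \<open>0 < e\<close> unfolding continuous_at_eps_delta dist_real_def
      by (metis half_gt_zero_iff)
    \<comment> \<open>By monotonicity of exp, the smaller of the two gaps at distance
      \<open>d\<close> from \<open>v\<close> bounds the distance of exp (- z) from exp (- v) for all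
      z at least that far away.\<close>
    define \<eta> where "\<eta> = min (exp (- v) - exp (- (v + d))) (exp (- (v - d)) - exp (- v))"
    have \<eta>: "0 < \<eta>"
      using d by (simp add: \<eta>_def)
    have far: "\<eta>\<^sup>2 \<le> (exp (- z) - exp (- v))\<^sup>2" if "d \<le> \<bar>z - v\<bar>" for z
    proof -
      have "\<eta> \<le> \<bar>exp (- z) - exp (- v)\<bar>"
      proof (cases "z \<ge> v")
        case True
        then have "exp (- z) \<le> exp (- (v + d))" using that by simp
        then show ?thesis unfolding \<eta>_def by linarith
      next
        case False
        then have "exp (- (v - d)) \<le> exp (- z)" using that by simp
        then show ?thesis unfolding \<eta>_def by linarith
      qed
      then show ?thesis
        using \<eta> by (metis abs_le_square_iff abs_of_pos)
    qed
    \<comment> \<open>As in Chebyshev's inequality: near \<open>v\<close> continuity gives e / 2,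
      and elsewhere the trivial bound 2 C is at most 2 C times W / eta^2, as W is at least eta^2
      there.\<close>
    have pointwise: "\<bar>\<Psi> (Z n \<omega>) - \<Psi> v\<bar> \<le> e / 2 + 2 * C / \<eta>\<^sup>2 * W n \<omega>" for n \<omega>
    proof (cases "\<bar>Z n \<omega> - v\<bar> < d")
      case True
      moreover have "0 \<le> 2 * C / \<eta>\<^sup>2 * W n \<omega>"
        using \<open>0 \<le> C\<close> by (simp add: W_def)
      ultimately show ?thesis
        using d(2)[of "Z n \<omega>"] by linarith
    next
      case False
      then have "2 * C * \<eta>\<^sup>2 \<le> 2 * C * W n \<omega>"
        using far[of "Z n \<omega>"] \<open>0 \<le> C\<close> unfolding W_def by (intro mult_left_mono) auto
      then have "2 * C \<le> 2 * C / \<eta>\<^sup>2 * W n \<omega>"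
        using \<eta> by (simp add: field_simps)
      moreover have "\<bar>\<Psi> (Z n \<omega>) - \<Psi> v\<bar> \<le> 2 * C"
        using bounded[of "Z n \<omega>"] bounded[of v] by linarith
      ultimately show ?thesis
        using \<open>0 < e\<close> by linarith
    qed
    have int_\<Psi>: "integrable M (\<lambda>\<omega>. \<Psi> (Z n \<omega>))" for n
      using bounded by (intro integrable_const_bound[where B = C]) auto
    have mean: "\<bar>expectation (\<lambda>\<omega>. \<Psi> (Z n \<omega>)) - \<Psi> v\<bar> \<le> e / 2 + 2 * C / \<eta>\<^sup>2 * expectation (W n)" for n
    proof -
      have "expectation (\<lambda>\<omega>. \<Psi> (Z n \<omega>)) - \<Psi> v = expectation (\<lambda>\<omega>. \<Psi> (Z n \<omega>) - \<Psi> v)"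
        using int_\<Psi> by (simp add: prob_space)
      also have "\<bar>\<dots>\<bar> \<le> expectation (\<lambda>\<omega>. \<bar>\<Psi> (Z n \<omega>) - \<Psi> v\<bar>)"
        by (rule integral_abs_bound)
      also have "\<dots> \<le> expectation (\<lambda>\<omega>. e / 2 + 2 * C / \<eta>\<^sup>2 * W n \<omega>)"
        using int_\<Psi> int_W pointwise by (intro integral_mono) auto
      also have "\<dots> = e / 2 + 2 * C / \<eta>\<^sup>2 * expectation (W n)"
        using int_W by (simp add: prob_space)
      finally show ?thesis .
    qed
    have "(\<lambda>n. 2 * C / \<eta>\<^sup>2 * expectation (W n)) \<longlonglongrightarrow> 2 * C / \<eta>\<^sup>2 * 0"
      by (intro tendsto_intros W_lim)
    then have "eventually (\<lambda>n. 2 * C / \<eta>\<^sup>2 * expectation (W n) < e / 2) sequentially"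
      using \<open>0 < e\<close> by (intro order_tendstoD) auto
    then obtain n0 where n0: "\<And>n. n \<ge> n0 \<Longrightarrow> 2 * C / \<eta>\<^sup>2 * expectation (W n) < e / 2"
      unfolding eventually_sequentially by blast
    show "\<exists>n0. \<forall>n\<ge>n0. norm (expectation (\<lambda>\<omega>. \<Psi> (Z n \<omega>)) - \<Psi> v) < e"
    proof (intro exI allI impI)
      fix n assume "n0 \<le> n"
      from n0[OF this] mean[of n] show "norm (expectation (\<lambda>\<omega>. \<Psi> (Z n \<omega>)) - \<Psi> v) < e"
        by simp
    qed
  qed
qed

text \<open>Scaling puts the dependence on the variance into the integrand over a fixed law, so
  dominated convergence with the constant \<open>C\<close> applies. \<open>sqrt\<close> is
  continuous on the whole line, which includes the degenerate variance 0.\<close>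

lemma isCont_integral_centered_normal:
  fixes h :: "real \<Rightarrow> real"
  assumes h: "continuous_on UNIV h" and bounded: "\<And>y. \<bar>h y\<bar> \<le> C"
  shows "isCont (\<lambda>v. \<integral>y. h y \<partial>centered_normal v) v"
  unfolding continuous_at_sequentially comp_def
proof (intro allI impI)
  fix u :: "nat \<Rightarrow> real" assume u: "u \<longlonglongrightarrow> v"
  interpret std: prob_space std_normal_distribution
    by (rule prob_space_std_normal)
  have [measurable]: "h \<in> borel_measurable borel"
    using h by (rule borel_measurable_continuous_onI)
  have "(\<lambda>n. \<integral>y. h (sqrt (u n) * y) \<partial>std_normal_distribution) \<longlonglongrightarrow>
      (\<integral>y. h (sqrt v * y) \<partial>std_normal_distribution)"
  proof (rule integral_dominated_convergence[where w = "\<lambda>_. C"])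
    show "AE y in std_normal_distribution. (\<lambda>n. h (sqrt (u n) * y)) \<longlonglongrightarrow> h (sqrt v * y)"
    proof (rule AE_I2)
      fix y
      have "(\<lambda>n. sqrt (u n) * y) \<longlonglongrightarrow> sqrt v * y"
        by (intro tendsto_intros u)
      moreover have "isCont h (sqrt v * y)"
        using h by (simp add: continuous_on_eq_continuous_at)
      ultimately show "(\<lambda>n. h (sqrt (u n) * y)) \<longlonglongrightarrow> h (sqrt v * y)"
        by (rule isCont_tendsto_compose[rotated])
    qed
  qed (use bounded in auto)
  then show "(\<lambda>n. \<integral>y. h y \<partial>centered_normal (u n)) \<longlonglongrightarrow> (\<integral>y. h y \<partial>centered_normal v)"
    by (simp add: integral_centered_normal)
qed

text \<open>Removes the truncation to \<open>A\<close> from test functions that read only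
  coordinates in \<open>A\<close>.\<close>

lemma converges_fdd_integral_tendsto:
  fixes g :: "('s \<Rightarrow> real) \<Rightarrow> real"
  assumes "converges_fdd P X M Y S" "finite A" "A \<subseteq> S" "continuous_on UNIV g" "\<And>s. \<bar>g s\<bar> \<le> C"
    and "\<And>s s'. (\<And>a. a \<in> A \<Longrightarrow> s a = s' a) \<Longrightarrow> g s = g s'"
  shows "(\<lambda>n. \<integral>\<theta>. g (\<lambda>s. X n s \<theta>) \<partial>P) \<longlonglongrightarrow> (\<integral>\<omega>. g (\<lambda>s. Y s \<omega>) \<partial>M)"
proof -
  have "bounded (range g)"
    using assms(5) by (intro boundedI[of _ C]) auto
  then have "(\<lambda>n. \<integral>\<theta>. g (\<lambda>s\<in>A. X n s \<theta>) \<partial>P) \<longlonglongrightarrow> (\<integral>\<omega>. g (\<lambda>s\<in>A. Y s \<omega>) \<partial>M)"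
    using assms(1-4) unfolding converges_fdd_def by blast
  moreover have "g (\<lambda>s\<in>A. f s) = g f" for f
    by (rule assms(6)) simp
  ultimately show ?thesis by simp
qed

lemma gaussian_process_linear_combination:
  assumes "centered_gaussian_process M k f" "finite S"
  shows "distr M borel (\<lambda>\<omega>. \<Sum>s\<in>S. c s * f s \<omega>) =
      centered_normal (\<Sum>s\<in>S. \<Sum>s'\<in>S. c s * c s' * k s s')"
    and "0 \<le> (\<Sum>s\<in>S. \<Sum>s'\<in>S. c s * c s' * k s s')"
  using assms by (auto simp: centered_gaussian_process_def Let_def centered_normal_def)

text \<open>
  The scalar-output limit identifies the limit of the conditional variance of an output given the
  hidden layers as a constant, which makes the outputs of the wide network independent.
\<close>

theorem initial_limit_product_expectation:
  fixes F :: "real^'d::finite \<Rightarrow> 'v \<Rightarrow> real" and U :: "nat \<Rightarrow> real^'d \<Rightarrow> 'w \<Rightarrow> real"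
    and h :: "nat \<Rightarrow> real \<Rightarrow> real"
  assumes L: "1 \<le> L" and \<phi>: "\<phi> \<in> borel_measurable borel"
    and F_init: "is_initial_limit \<phi> \<sigma>w \<sigma>b L 1 N (\<lambda>_. F)"
    and F_gp: "centered_gaussian_process N \<kappa> F"
    and U_init: "is_initial_limit \<phi> \<sigma>w \<sigma>b L K M U"
    and S: "finite S"
    and h: "\<And>i. continuous_on UNIV (h i)" "\<And>i y. \<bar>h i y\<bar> \<le> 1"
  shows "(\<integral>\<omega>. (\<Prod>i\<in>{1..K}. h i (\<Sum>x\<in>S. c x * U i x \<omega>)) \<partial>M) =
    (\<Prod>i\<in>{1..K}. \<integral>y. h i y \<partial>centered_normal (\<Sum>x\<in>S. \<Sum>x'\<in>S. c x * c x' * \<kappa> x x'))"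
proof -
  interpret prob_space init_measure by (rule prob_space_init_measure)
  define v where "v = (\<Sum>x\<in>S. \<Sum>x'\<in>S. c x * c x' * \<kappa> x x')"
  have v_nonneg: "0 \<le> v" and F_law: "distr N borel (\<lambda>\<omega>. \<Sum>x\<in>S. c x * F x \<omega>) = centered_normal v"
    using gaussian_process_linear_combination[OF F_gp S] by (simp_all add: v_def)
  have [measurable]: "F x \<in> borel_measurable N" for x
    using F_gp by (simp add: centered_gaussian_process_def)
  let ?V = "\<lambda>n. output_variance \<phi> \<sigma>w \<sigma>b L n S c"
  have V_nonneg: "0 \<le> ?V n \<theta>" for n \<theta>
    by (simp add: output_variance_def sum_nonneg)
  \<comment> \<open>Computed in two ways: at finite width the expected cosine of the linear
    combination is the Laplace transform of its conditional variance at t^2/2, and in the limit it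
    is the characteristic function of a normal law of variance \<open>v\<close>.\<close>
  have laplace: "(\<lambda>n. expectation (\<lambda>\<theta>. exp (- (?V n \<theta> * t\<^sup>2) / 2))) \<longlonglongrightarrow> exp (- (v * t\<^sup>2) / 2)" for t
  proof -
    have "(\<lambda>n. expectation (\<lambda>\<theta>. cos (t * (\<Sum>x\<in>S. c x * net \<phi> \<sigma>w \<sigma>b L n 1 x \<theta>)))) \<longlonglongrightarrow>
        (\<integral>\<omega>. cos (t * (\<Sum>x\<in>S. c x * F x \<omega>)) \<partial>N)"
    proof -
      let ?g = "\<lambda>s. cos (t * (\<Sum>x\<in>S. c x * s (1::nat, x)))"
      have "(\<lambda>n. expectation (\<lambda>\<theta>. ?g (\<lambda>s. (case s of (i, x) \<Rightarrow> net \<phi> \<sigma>w \<sigma>b L n i x) \<theta>))) \<longlonglongrightarrow>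
          (\<integral>\<omega>. ?g (\<lambda>s. (case s of (i, x) \<Rightarrow> F x) \<omega>) \<partial>N)"
      proof (rule converges_fdd_integral_tendsto[OF F_init[unfolded is_initial_limit_def], of "{1} \<times> S" _ 1])
        have "continuous_on UNIV (cos :: real \<Rightarrow> real)"
          by (intro continuous_intros)
        then show "continuous_on UNIV ?g"
          by (rule continuous_on_compose2)
            (intro continuous_on_mult continuous_on_sum continuous_on_const
              continuous_on_product_coordinates, simp)
      qed (use S in auto)
      then show ?thesis by simp
    qed
    moreover have "expectation (\<lambda>\<theta>. cos (t * (\<Sum>x\<in>S. c x * net \<phi> \<sigma>w \<sigma>b L n 1 x \<theta>))) =
        expectation (\<lambda>\<theta>. exp (- (?V n \<theta> * t\<^sup>2) / 2))" for n
      using integral_prod_net[OF L \<phi>, of "{1}" "\<lambda>_ y. cos (t * y)" 1 c \<sigma>w \<sigma>b n S]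
      by (simp add: integral_cos_centered_normal V_nonneg)
    moreover have "(\<integral>\<omega>. cos (t * (\<Sum>x\<in>S. c x * F x \<omega>)) \<partial>N) = exp (- (v * t\<^sup>2) / 2)"
    proof -
      have "(\<integral>\<omega>. cos (t * (\<Sum>x\<in>S. c x * F x \<omega>)) \<partial>N) =
          (\<integral>y. cos (t * y) \<partial>distr N borel (\<lambda>\<omega>. \<Sum>x\<in>S. c x * F x \<omega>))"
        by (subst integral_distr) auto
      then show ?thesis
        by (simp add: F_law integral_cos_centered_normal v_nonneg)
    qed
    ultimately show ?thesis by simp
  qed
  \<comment> \<open>The conditional expectation of the product, given that the conditional variance
    is \<open>z\<close>. It is bounded and continuous, so it may be evaluated at the limit
    \<open>v\<close>, where it is a product of separate expectations.\<close>
  define \<Psi> where "\<Psi> z = (\<Prod>i\<in>{1..K}. \<integral>y. h i y \<partial>centered_normal z)" for z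
  have \<Psi>_cont: "isCont \<Psi> z" for z
    unfolding \<Psi>_def by (intro continuous_intros isCont_integral_centered_normal[OF h])
  have \<Psi>_bound: "\<bar>\<Psi> z\<bar> \<le> 1" for z
  proof -
    interpret N: real_distribution "centered_normal z"
      by (rule real_distribution_centered_normal)
    have [measurable]: "h i \<in> borel_measurable borel" for i
      using h(1) by (rule borel_measurable_continuous_onI)
    have "\<bar>\<integral>y. h i y \<partial>centered_normal z\<bar> \<le> 1" for i
    proof -
      have "\<bar>\<integral>y. h i y \<partial>centered_normal z\<bar> \<le> (\<integral>y. \<bar>h i y\<bar> \<partial>centered_normal z)"
        by (rule integral_abs_bound)
      also have "\<dots> \<le> (\<integral>y. 1 \<partial>centered_normal z)"
        using h(2) by (intro integral_mono N.integrable_const_bound[where B = 1]) auto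
      also have "(\<integral>y. 1 \<partial>centered_normal z) \<le> (1::real)"
        by simp
      finally show ?thesis .
    qed
    then show ?thesis
      unfolding \<Psi>_def abs_prod by (intro prod_le_1) auto
  qed
  have "(\<lambda>n. expectation (\<lambda>\<theta>. \<Psi> (?V n \<theta>))) \<longlonglongrightarrow> \<Psi> v"
  proof (rule expectation_tendsto_of_laplace[OF _ _ _ _ _ \<Psi>_bound \<Psi>_cont])
    show "\<Psi> \<in> borel_measurable borel"
      using \<Psi>_cont by (intro borel_measurable_continuous_onI continuous_at_imp_continuous_on) auto
    show "?V n \<in> borel_measurable init_measure" for n
      by (rule output_variance_measurable[OF \<phi>])
    \<comment> \<open>The parameters \<open>sqrt 2\<close> and 2 are chosen so that t^2/2 is 1 and
      2.\<close>
    show "(\<lambda>n. expectation (\<lambda>\<theta>. exp (- ?V n \<theta>))) \<longlonglongrightarrow> exp (- v)"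
      using laplace[of "sqrt 2"] by simp
    show "(\<lambda>n. expectation (\<lambda>\<theta>. exp (- (2 * ?V n \<theta>)))) \<longlonglongrightarrow> exp (- (2 * v))"
      using laplace[of 2] by (simp add: mult.commute)
  qed (rule V_nonneg)
  moreover have "expectation (\<lambda>\<theta>. \<Prod>i\<in>{1..K}. h i (\<Sum>x\<in>S. c x * net \<phi> \<sigma>w \<sigma>b L n i x \<theta>)) =
      expectation (\<lambda>\<theta>. \<Psi> (?V n \<theta>))" for n
    unfolding \<Psi>_def using h
    by (intro integral_prod_net[OF L \<phi>, of _ _ 1]) (auto intro: borel_measurable_continuous_onI)
  moreover have "(\<lambda>n. expectation (\<lambda>\<theta>. \<Prod>i\<in>{1..K}. h i (\<Sum>x\<in>S. c x * net \<phi> \<sigma>w \<sigma>b L n i x \<theta>))) \<longlonglongrightarrow>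
      (\<integral>\<omega>. (\<Prod>i\<in>{1..K}. h i (\<Sum>x\<in>S. c x * U i x \<omega>)) \<partial>M)"
  proof -
    let ?g = "\<lambda>s. \<Prod>i\<in>{1..K}. h i (\<Sum>x\<in>S. c x * s (i, x))"
    have "(\<lambda>n. expectation (\<lambda>\<theta>. ?g (\<lambda>s. (case s of (i, x) \<Rightarrow> net \<phi> \<sigma>w \<sigma>b L n i x) \<theta>))) \<longlonglongrightarrow>
        (\<integral>\<omega>. ?g (\<lambda>s. (case s of (i, x) \<Rightarrow> U i x) \<omega>) \<partial>M)"
    proof (rule converges_fdd_integral_tendsto[OF U_init[unfolded is_initial_limit_def], of "{1..K} \<times> S" _ 1])
      show "continuous_on UNIV ?g"
        by (intro continuous_intros continuous_on_compose2[OF h(1)] continuous_on_product_coordinates) auto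
      show "\<bar>?g s\<bar> \<le> 1" for s
        unfolding abs_prod using h(2) by (intro prod_le_1) auto
    qed (use S in auto)
    then show ?thesis by simp
  qed
  ultimately show ?thesis
    unfolding v_def[symmetric] \<Psi>_def[symmetric] using LIMSEQ_unique by auto
qed

section \<open>Laws from product expectations\<close>

text \<open>Piecewise linear: 1 up to \<open>a\<close> and, for positive \<open>k\<close>, 0 from a
  + 1/k on. These functions carry identities for continuous test functions over to distribution
  functions.\<close>

definition ramp :: "real \<Rightarrow> nat \<Rightarrow> real \<Rightarrow> real" where
  "ramp a k y = max 0 (min 1 (1 - real k * (y - a)))"

lemma ramp_tendsto: "(\<lambda>k. ramp a k y) \<longlonglongrightarrow> indicator {..a} y"
proof (cases "y \<le> a")
  case True
  then have "ramp a k y = 1" for k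
    by (simp add: ramp_def mult_le_0_iff)
  then show ?thesis using True by simp
next
  case False
  have "eventually (\<lambda>k. ramp a k y = 0) sequentially"
  proof -
    obtain k0 :: nat where "1 / (y - a) < real k0"
      using reals_Archimedean2 by blast
    then have "1 < real k0 * (y - a)"
      using False by (simp add: field_simps)
    then have "ramp a k y = 0" if "k0 \<le> k" for k
    proof -
      have "real k0 * (y - a) \<le> real k * (y - a)"
        using that False by (intro mult_right_mono) auto
      with \<open>1 < real k0 * (y - a)\<close> show ?thesis
        by (simp add: ramp_def)
    qed
    then show ?thesis
      by (auto simp: eventually_sequentially)
  qed
  then show ?thesis
    using False by (auto simp: tendsto_eventually)
qed

lemma ramp_bounds: "0 \<le> ramp a k y" "ramp a k y \<le> 1" "\<bar>ramp a k y\<bar> \<le> 1"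
  by (auto simp: ramp_def)

lemma continuous_on_ramp: "continuous_on UNIV (ramp a k)"
  unfolding ramp_def by (intro continuous_intros)

lemma ramp_measurable [measurable]: "ramp a k \<in> borel_measurable borel"
  by (rule borel_measurable_continuous_onI) (rule continuous_on_ramp)

text \<open>Ramps and dominated convergence extend the product formula from continuous test
  functions to indicators of half-lines. Single indices then give the distribution functions, and
  several indices give independence of the half-line events.\<close>

lemma (in prob_space) indep_vars_of_product_expectations:
  fixes X :: "'i \<Rightarrow> 'a \<Rightarrow> real"
  assumes I: "finite I" and X: "\<And>i. i \<in> I \<Longrightarrow> random_variable borel (X i)"
    and \<mu>: "\<And>i. i \<in> I \<Longrightarrow> real_distribution (\<mu> i)"
    and product: "\<And>h :: 'i \<Rightarrow> real \<Rightarrow> real. (\<And>i. continuous_on UNIV (h i)) \<Longrightarrow> (\<And>i y. \<bar>h i y\<bar> \<le> 1) \<Longrightarrow>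
      expectation (\<lambda>\<omega>. \<Prod>i\<in>I. h i (X i \<omega>)) = (\<Prod>i\<in>I. \<integral>y. h i y \<partial>\<mu> i)"
  shows "indep_vars (\<lambda>_. borel) X I" and "\<And>i. i \<in> I \<Longrightarrow> distr M borel (X i) = \<mu> i"
proof -
  note X [measurable]
  have joint: "prob (\<Inter>i\<in>J. X i -` {..a i} \<inter> space M) = (\<Prod>i\<in>J. measure (\<mu> i) {..a i})"
    if J: "J \<subseteq> I" "J \<noteq> {}" for J and a :: "'i \<Rightarrow> real"
  proof -
    \<comment> \<open>The constant 1 outside \<open>J\<close> reduces the product over
      \<open>I\<close> to one over \<open>J\<close>, since independence concerns every
      subfamily.\<close>
    define h where "h k i = (if i \<in> J then ramp (a i) k else (\<lambda>_. 1))" for k i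
    define h' :: "'i \<Rightarrow> real \<Rightarrow> real" where "h' i = (if i \<in> J then indicator {..a i} else (\<lambda>_. 1))" for i
    have [measurable]: "h k i \<in> borel_measurable borel" "h' i \<in> borel_measurable borel" for k i
      by (auto simp: h_def h'_def)
    have h_bound: "\<bar>h k i y\<bar> \<le> 1" for k i y
      by (simp add: h_def ramp_bounds)
    have h_lim: "(\<lambda>k. h k i y) \<longlonglongrightarrow> h' i y" for i y
      by (simp add: h_def h'_def ramp_tendsto)
    have "(\<lambda>k. expectation (\<lambda>\<omega>. \<Prod>i\<in>I. h k i (X i \<omega>))) \<longlonglongrightarrow> expectation (\<lambda>\<omega>. \<Prod>i\<in>I. h' i (X i \<omega>))"
    proof (rule integral_dominated_convergence[where w = "\<lambda>_. 1"])
      show "AE \<omega> in M. (\<lambda>k. \<Prod>i\<in>I. h k i (X i \<omega>)) \<longlonglongrightarrow> (\<Prod>i\<in>I. h' i (X i \<omega>))"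
        by (intro AE_I2 tendsto_prod h_lim)
      show "AE \<omega> in M. norm (\<Prod>i\<in>I. h k i (X i \<omega>)) \<le> 1" for k
        using h_bound by (intro AE_I2) (auto simp: abs_prod intro!: prod_le_1)
    qed measurable
    moreover have "(\<lambda>k. \<Prod>i\<in>I. \<integral>y. h k i y \<partial>\<mu> i) \<longlonglongrightarrow> (\<Prod>i\<in>I. \<integral>y. h' i y \<partial>\<mu> i)"
    proof (rule tendsto_prod)
      fix i assume "i \<in> I"
      then interpret \<mu>i: real_distribution "\<mu> i" by (rule \<mu>)
      show "(\<lambda>k. \<integral>y. h k i y \<partial>\<mu> i) \<longlonglongrightarrow> (\<integral>y. h' i y \<partial>\<mu> i)"
        by (rule integral_dominated_convergence[where w = "\<lambda>_. 1"]) (use h_bound h_lim in auto)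
    qed
    moreover have "expectation (\<lambda>\<omega>. \<Prod>i\<in>I. h k i (X i \<omega>)) = (\<Prod>i\<in>I. \<integral>y. h k i y \<partial>\<mu> i)" for k
      by (rule product[of "h k"]) (simp_all add: h_bound, simp add: h_def continuous_on_ramp)
    ultimately have "expectation (\<lambda>\<omega>. \<Prod>i\<in>I. h' i (X i \<omega>)) = (\<Prod>i\<in>I. \<integral>y. h' i y \<partial>\<mu> i)"
      using LIMSEQ_unique by auto
    also have "(\<Prod>i\<in>I. \<integral>y. h' i y \<partial>\<mu> i) = (\<Prod>i\<in>J. \<integral>y. h' i y \<partial>\<mu> i)"
    proof (rule prod.mono_neutral_right[OF I J(1)], rule ballI)
      fix i assume "i \<in> I - J"
      then interpret \<mu>i: real_distribution "\<mu> i" by (auto intro: \<mu>)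
      show "(\<integral>y. h' i y \<partial>\<mu> i) = 1"
        using \<open>i \<in> I - J\<close> \<mu>i.prob_space by (simp add: h'_def)
    qed
    also have "\<dots> = (\<Prod>i\<in>J. measure (\<mu> i) {..a i})"
    proof (rule prod.cong[OF refl])
      fix i assume i: "i \<in> J"
      then interpret \<mu>i: real_distribution "\<mu> i" using J by (auto intro: \<mu>)
      show "(\<integral>y. h' i y \<partial>\<mu> i) = measure (\<mu> i) {..a i}"
        using i by (simp add: h'_def)
    qed
    also have "expectation (\<lambda>\<omega>. \<Prod>i\<in>I. h' i (X i \<omega>)) =
        expectation (indicator (\<Inter>i\<in>J. X i -` {..a i} \<inter> space M))"
    proof (rule Bochner_Integration.integral_cong[OF refl])
      fix \<omega> assume \<omega>: "\<omega> \<in> space M"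
      have "(\<Prod>i\<in>I. h' i (X i \<omega>)) = (\<Prod>i\<in>J. indicator {..a i} (X i \<omega>))"
        using J by (intro prod.mono_neutral_cong_right[OF I]) (auto simp: h'_def)
      also have "\<dots> = indicator (\<Inter>i\<in>J. X i -` {..a i} \<inter> space M) \<omega>"
      proof (cases "\<forall>i\<in>J. X i \<omega> \<le> a i")
        case True
        then show ?thesis using \<omega> J by (simp add: indicator_def)
      next
        case False
        have "finite J" using I J by (auto intro: finite_subset)
        with False have "(\<Prod>i\<in>J. indicator {..a i} (X i \<omega>)) = (0::real)"
          by (intro prod_zero) (auto simp: indicator_def)
        then show ?thesis using False by (auto simp: indicator_def)
      qed
      finally show "(\<Prod>i\<in>I. h' i (X i \<omega>)) = indicator (\<Inter>i\<in>J. X i -` {..a i} \<inter> space M) \<omega>" .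
    qed
    also have "\<dots> = prob (\<Inter>i\<in>J. X i -` {..a i} \<inter> space M)"
    proof -
      have "(\<Inter>i\<in>J. X i -` {..a i} \<inter> space M) \<subseteq> space M"
        using J by auto
      then show ?thesis
        by (simp add: Int_absorb2)
    qed
    finally show ?thesis .
  qed
  show law: "distr M borel (X i) = \<mu> i" if i: "i \<in> I" for i
  proof (rule cdf_unique)
    show "real_distribution (distr M borel (X i))"
      using i by (intro real_distribution_distr X)
    show "real_distribution (\<mu> i)"
      using i by (rule \<mu>)
    show "cdf (distr M borel (X i)) = cdf (\<mu> i)"
    proof
      fix a
      show "cdf (distr M borel (X i)) a = cdf (\<mu> i) a"
        using joint[of "{i}" "\<lambda>_. a"] i by (simp add: cdf_def measure_distr)
    qed
  qed
  \<comment> \<open>Preimages of half-lines are stable under intersection and generate all preimages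
    of Borel sets, so independence extends from the former to the latter.\<close>
  define E where "E i = {X i -` {..a} \<inter> space M | a. True}" for i
  have "indep_sets E I"
    unfolding indep_sets_def
  proof (intro conjI ballI allI impI)
    fix i assume "i \<in> I"
    then show "E i \<subseteq> events"
      unfolding E_def by (auto intro!: measurable_sets[OF X])
  next
    fix J A assume J: "J \<subseteq> I" "J \<noteq> {}" "finite J" and A: "A \<in> Pi J E"
    then have "\<forall>i\<in>J. \<exists>a. A i = X i -` {..a} \<inter> space M"
      by (auto simp: E_def Pi_iff)
    then obtain a where a: "\<And>i. i \<in> J \<Longrightarrow> A i = X i -` {..a i} \<inter> space M"
      by metis
    have "prob (A i) = measure (\<mu> i) {..a i}" if "i \<in> J" for i
      using joint[of "{i}" a] that J by (auto simp: a)
    then show "prob (\<Inter>i\<in>J. A i) = (\<Prod>i\<in>J. prob (A i))"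
      using joint[OF J(1,2), of a] a by simp
  qed
  then have "indep_sets (\<lambda>i. sigma_sets (space M) (E i)) I"
  proof (rule indep_sets_sigma)
    fix i
    show "Int_stable (E i)"
    proof (rule Int_stableI)
      fix A B assume "A \<in> E i" "B \<in> E i"
      then obtain a b where "A = X i -` {..a} \<inter> space M" "B = X i -` {..b} \<inter> space M"
        by (auto simp: E_def)
      then have "A \<inter> B = X i -` {..min a b} \<inter> space M"
        by auto
      then show "A \<inter> B \<in> E i"
        by (auto simp: E_def)
    qed
  qed
  moreover have "{X i -` A \<inter> space M | A. A \<in> sets borel} = sigma_sets (space M) (E i)" for i
  proof -
    have "{X i -` A \<inter> space M | A. A \<in> sets (borel :: real measure)} =
        {X i -` A \<inter> space M | A. A \<in> sigma_sets UNIV (range atMost)}"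
      by (simp add: borel_eq_atMost)
    also have "\<dots> = sigma_sets (space M) {X i -` A \<inter> space M | A. A \<in> range atMost}"
      by (rule sigma_sets_vimage_commute) simp
    also have "{X i -` A \<inter> space M | A. A \<in> range atMost} = E i"
      by (auto simp: E_def)
    finally show ?thesis .
  qed
  ultimately show "indep_vars (\<lambda>_. borel) X I"
    unfolding indep_vars_def2 using X by simp
qed

text \<open>The joint law of independent variables is the product of the marginals, each an image of
  the standard normal law. Any statistic can thus be evaluated on i.i.d. standard normals, also when
  \<open>v\<close> is 0.\<close>

lemma (in prob_space) distr_of_scaled_std_normal:
  assumes indep: "indep_vars (\<lambda>_. borel) X I" and I: "finite I" "I \<noteq> {}"
    and law: "\<And>i. i \<in> I \<Longrightarrow> distr M borel (X i) = centered_normal v"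
    and g: "g \<in> borel_measurable (\<Pi>\<^sub>M i\<in>I. borel)"
  shows "distr M borel (\<lambda>\<omega>. g (\<lambda>i\<in>I. X i \<omega>)) =
    distr (\<Pi>\<^sub>M i\<in>I. std_normal_distribution) borel (\<lambda>z. g (\<lambda>i\<in>I. sqrt v * z i))"
proof -
  have X: "random_variable borel (X i)" if "i \<in> I" for i
    using indep that by (simp add: indep_vars_def)
  have "distr M (\<Pi>\<^sub>M i\<in>I. borel) (\<lambda>\<omega>. \<lambda>i\<in>I. X i \<omega>) = (\<Pi>\<^sub>M i\<in>I. distr M borel (X i))"
    using indep I X by (subst (asm) indep_vars_iff_distr_eq_PiM') auto
  also have "\<dots> = (\<Pi>\<^sub>M i\<in>I. distr std_normal_distribution std_normal_distribution (\<lambda>y. sqrt v * y))"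
    by (intro PiM_cong refl) (auto simp: law centered_normal_def intro!: distr_cong)
  also have "\<dots> = distr (\<Pi>\<^sub>M i\<in>I. std_normal_distribution) (\<Pi>\<^sub>M i\<in>I. std_normal_distribution)
      (compose I (\<lambda>y. sqrt v * y))"
    using I(1) by (intro distr_PiM_finite_prob_space'[symmetric] prob_space_std_normal) auto
  also have "\<dots> = distr (\<Pi>\<^sub>M i\<in>I. std_normal_distribution) (\<Pi>\<^sub>M i\<in>I. borel)
      (compose I (\<lambda>y. sqrt v * y))"
    by (intro distr_cong sets_PiM_cong) auto
  finally have "distr (distr M (\<Pi>\<^sub>M i\<in>I. borel) (\<lambda>\<omega>. \<lambda>i\<in>I. X i \<omega>)) borel g =
      distr (distr (\<Pi>\<^sub>M i\<in>I. std_normal_distribution) (\<Pi>\<^sub>M i\<in>I. borel) (compose I (\<lambda>y. sqrt v * y))) borel g"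
    by simp
  moreover have "(\<lambda>\<omega>. \<lambda>i\<in>I. X i \<omega>) \<in> measurable M (\<Pi>\<^sub>M i\<in>I. borel)"
    by (intro measurable_restrict X)
  moreover have "compose I (\<lambda>y. sqrt v * y) \<in> measurable (\<Pi>\<^sub>M i\<in>I. std_normal_distribution) (\<Pi>\<^sub>M i\<in>I. borel)"
    unfolding compose_def by (intro measurable_restrict) simp
  ultimately show ?thesis
    using g by (simp add: distr_distr comp_def compose_def)
qed

section \<open>Gradient flow\<close>

text \<open>The constant is the minimum of the quadratic form on the unit sphere, attained by
  compactness and hence positive; scaling gives the bound for all vectors.\<close>

lemma positive_definite_coercive:
  assumes "positive_definite A"
  obtains c where "c > 0" "\<And>v. c * (norm v)\<^sup>2 \<le> v \<bullet> (A *v v)"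
proof -
  have "continuous_on (sphere 0 1) (\<lambda>v. v \<bullet> (A *v v))"
    by (intro continuous_intros linear_continuous_on matrix_vector_mul_bounded_linear)
  moreover have "sphere (0::real^'a) 1 \<noteq> {}"
    by simp
  ultimately obtain u where u: "norm u = 1" "\<And>v. norm v = 1 \<Longrightarrow> u \<bullet> (A *v u) \<le> v \<bullet> (A *v v)"
    using continuous_attains_inf[of "sphere (0::real^'a) 1" "\<lambda>v. v \<bullet> (A *v v)"] by auto
  have "u \<noteq> 0"
    using u(1) by auto
  show thesis
  proof (rule that)
    show "0 < u \<bullet> (A *v u)"
      using assms \<open>u \<noteq> 0\<close> by (simp add: positive_definite_def)
    show "u \<bullet> (A *v u) * (norm v)\<^sup>2 \<le> v \<bullet> (A *v v)" for v
    proof (cases "v = 0")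
      case False
      define w where "w = (1 / norm v) *\<^sub>R v"
      have w: "norm w = 1" and v: "v = norm v *\<^sub>R w"
        using False by (simp_all add: w_def)
      have "v \<bullet> (A *v v) = (norm v)\<^sup>2 * (w \<bullet> (A *v w))"
        by (subst (1 2) v) (simp add: matrix_vector_mult_scaleR power2_eq_square)
      then show ?thesis
        using u(2)[OF w] by (simp add: mult.commute[of "(norm v)\<^sup>2"] mult_right_mono)
    qed simp
  qed
qed

lemma positive_definite_matrix_inv:
  assumes "positive_definite A"
  shows "A *v (matrix_inv A *v v) = v"
proof -
  have "x = 0" if "A *v x = 0" for x
    using assms that unfolding positive_definite_def by (metis inner_zero_right less_irrefl)
  then have "invertible A"
    using matrix_left_invertible_ker[of A] invertible_left_inverse[of A] by auto
  then have "A ** matrix_inv A = mat 1"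
    unfolding invertible_def matrix_inv_def by (rule someI_ex[THEN conjunct1])
  then show ?thesis
    by (simp add: matrix_vector_mul_assoc)
qed

lemma positive_definite_symmetric:
  assumes "positive_definite A"
  shows "(A *v v) \<bullet> w = v \<bullet> (A *v w)"
  using assms unfolding positive_definite_def
  by (metis dot_lmul_matrix transpose_matrix_vector)

text \<open>No matrix exponential is involved. The residual \<open>r\<close> on the training points
  decays by an energy estimate, and the difference of \<open>f t x\<close> and the combination
  \<open>w\<close> of the residuals is conserved, so its value at time 0 is the limit.\<close>

lemma scalar_gradient_flow_limit:
  fixes \<Theta> :: "'x \<Rightarrow> 'x \<Rightarrow> real" and X :: "'m::finite \<Rightarrow> 'x" and f :: "real \<Rightarrow> 'x \<Rightarrow> real"
  assumes pos_def: "positive_definite (kernel_matrix \<Theta> X)"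
    and flow: "\<And>x t. 0 \<le> t \<Longrightarrow> ((\<lambda>s. f s x) has_real_derivative
      - (\<Sum>a\<in>UNIV. \<Theta> x (X a) * (f t (X a) - Y a))) (at t within {0..})"
  shows "((\<lambda>t. f t x) \<longlongrightarrow>
    f 0 x - (\<Sum>a\<in>UNIV. (matrix_inv (kernel_matrix \<Theta> X) *v kernel_row \<Theta> x X) $ a * (f 0 (X a) - Y a))) at_top"
proof -
  let ?A = "kernel_matrix \<Theta> X"
  define r where "r t = (\<chi> a. f t (X a) - Y a)" for t
  define w where "w = matrix_inv ?A *v kernel_row \<Theta> x X"
  have r_deriv: "((\<lambda>s. r s $ a) has_real_derivative - (?A *v r t) $ a) (at t within {0..})"
    if "0 \<le> t" for a t
    unfolding r_def using flow[OF that, of "X a"]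
    by (auto intro!: derivative_eq_intros simp: kernel_matrix_def matrix_vector_mult_def)
  obtain c where c: "c > 0" "\<And>v. c * (norm v)\<^sup>2 \<le> v \<bullet> (?A *v v)"
    using positive_definite_coercive[OF pos_def] by blast
  \<comment> \<open>As r' = - A r, the derivative of the squared norm of \<open>r\<close> is at most
    - 2 c times that squared norm; the exponential weight compensates exactly this decay.\<close>
  define E where "E t = exp (2 * c * t) * (\<Sum>a\<in>UNIV. (r t $ a)\<^sup>2)" for t
  have norm_r: "(norm (r t))\<^sup>2 = (\<Sum>a\<in>UNIV. (r t $ a)\<^sup>2)" for t
    unfolding power2_norm_eq_inner inner_vec_def by (simp add: power2_eq_square)
  have E_deriv: "(E has_real_derivative
      2 * exp (2 * c * t) * (c * (norm (r t))\<^sup>2 - r t \<bullet> (?A *v r t))) (at t within {0..})"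
    if "0 \<le> t" for t
  proof -
    have "((\<lambda>t. \<Sum>a\<in>UNIV. (r t $ a)\<^sup>2) has_real_derivative
        (\<Sum>a\<in>UNIV. 2 * (r t $ a) * - (?A *v r t) $ a)) (at t within {0..})"
      using r_deriv[OF that] by (intro DERIV_sum) (auto intro!: derivative_eq_intros)
    moreover have "((\<lambda>t. exp (2 * c * t)) has_real_derivative 2 * c * exp (2 * c * t)) (at t within {0..})"
      by (auto intro!: derivative_eq_intros)
    ultimately have "(E has_real_derivative (2 * c * exp (2 * c * t)) * (\<Sum>a\<in>UNIV. (r t $ a)\<^sup>2) +
        (\<Sum>a\<in>UNIV. 2 * (r t $ a) * - (?A *v r t) $ a) * exp (2 * c * t)) (at t within {0..})"
      unfolding E_def by (rule DERIV_mult[rotated])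
    moreover have "(\<Sum>a\<in>UNIV. 2 * (r t $ a) * - (?A *v r t) $ a) = - 2 * (r t \<bullet> (?A *v r t))"
      by (simp add: inner_vec_def sum_distrib_left sum_negf mult.assoc)
    ultimately show ?thesis
      by (simp add: norm_r algebra_simps)
  qed
  have E_decreasing: "E t \<le> E 0" if "0 < t" for t
  \<comment> \<open>At time 0 the flow has only a one-sided derivative, so monotonicity is drawn
    from the open interval and continuity at the end points.\<close>
  proof (rule DERIV_nonpos_imp_decreasing_open[OF less_imp_le[OF that]])
    fix s assume s: "0 < s" "s < t"
    then have "at s within {0..} = at s"
      by (intro at_within_interior) simp
    then have "DERIV E s :> 2 * exp (2 * c * s) * (c * (norm (r s))\<^sup>2 - r s \<bullet> (?A *v r s))"
      using E_deriv[of s] s by simp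
    moreover have "2 * exp (2 * c * s) * (c * (norm (r s))\<^sup>2 - r s \<bullet> (?A *v r s)) \<le> 0"
      using c(2)[of "r s"] by (intro mult_nonneg_nonpos) auto
    ultimately show "\<exists>y. DERIV E s :> y \<and> y \<le> 0" by blast
  next
    have "continuous_on {0..} E"
      using E_deriv by (intro DERIV_continuous_on) auto
    then show "continuous_on {0..t} E"
      by (rule continuous_on_subset) auto
  qed
  have r_lim: "((\<lambda>t. r t $ a) \<longlongrightarrow> 0) at_top" for a
  proof -
    have bound: "(r t $ a)\<^sup>2 \<le> E 0 * exp (- (2 * c * t))" if "0 < t" for t
    proof -
      have "(r t $ a)\<^sup>2 \<le> (\<Sum>a\<in>UNIV. (r t $ a)\<^sup>2)"
        by (rule member_le_sum) auto
      also have "\<dots> = E t * exp (- (2 * c * t))"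
        by (simp add: E_def exp_minus)
      also have "\<dots> \<le> E 0 * exp (- (2 * c * t))"
        using E_decreasing[OF that] by (intro mult_right_mono) auto
      finally show ?thesis .
    qed
    have "filterlim (\<lambda>t. 2 * c * t) at_top at_top"
      using c(1) by (intro filterlim_tendsto_pos_mult_at_top[OF tendsto_const _ filterlim_ident]) simp
    then have "((\<lambda>t. exp (- (2 * c * t))) \<longlongrightarrow> 0) at_top"
      by (intro filterlim_compose[OF exp_at_bot] filterlim_uminus_at_bot[THEN iffD2]) simp
    then have "((\<lambda>t. E 0 * exp (- (2 * c * t))) \<longlongrightarrow> E 0 * 0) at_top"
      by (rule tendsto_mult_left)
    then have majorant: "((\<lambda>t. E 0 * exp (- (2 * c * t))) \<longlongrightarrow> 0) at_top"
      by simp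
    have "((\<lambda>t. (r t $ a)\<^sup>2) \<longlongrightarrow> 0) at_top"
    proof (rule tendsto_sandwich[OF _ _ tendsto_const majorant])
      show "\<forall>\<^sub>F t in at_top. (r t $ a)\<^sup>2 \<le> E 0 * exp (- (2 * c * t))"
        using eventually_gt_at_top[of 0] by (rule eventually_mono) (rule bound)
    qed simp
    then have "((\<lambda>t. sqrt ((r t $ a)\<^sup>2)) \<longlongrightarrow> sqrt 0) at_top"
      by (rule tendsto_real_sqrt)
    then show ?thesis
      by (simp add: tendsto_rabs_zero_iff)
  qed
  \<comment> \<open>Since A w is the kernel row of \<open>x\<close> and A is symmetric, the
    derivative of the combination \<open>w\<close> of \<open>r\<close> is minus the kernel row
    applied to \<open>r\<close>, which is the derivative of \<open>f t x\<close>.\<close>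
  have "\<exists>d. \<forall>t\<in>{0..}. f t x - w \<bullet> r t = d"
  proof (rule has_field_derivative_zero_constant)
    fix t :: real assume "t \<in> {0..}"
    then have t: "0 \<le> t" by simp
    have "w \<bullet> (?A *v r t) = (?A *v w) \<bullet> r t"
      by (simp add: positive_definite_symmetric[OF pos_def])
    also have "?A *v w = kernel_row \<Theta> x X"
      unfolding w_def by (rule positive_definite_matrix_inv[OF pos_def])
    finally have w: "w \<bullet> (?A *v r t) = (\<Sum>a\<in>UNIV. \<Theta> x (X a) * (f t (X a) - Y a))"
      by (simp add: inner_vec_def kernel_row_def r_def)
    have "((\<lambda>t. w \<bullet> r t) has_real_derivative (\<Sum>a\<in>UNIV. w $ a * - (?A *v r t) $ a)) (at t within {0..})"
      unfolding inner_vec_def inner_real_def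
      by (intro DERIV_sum DERIV_cmult r_deriv t)
    moreover have "(\<Sum>a\<in>UNIV. w $ a * - (?A *v r t) $ a) = - (w \<bullet> (?A *v r t))"
      by (simp add: inner_vec_def sum_negf)
    ultimately have "((\<lambda>t. w \<bullet> r t) has_real_derivative - (w \<bullet> (?A *v r t))) (at t within {0..})"
      by simp
    from DERIV_diff[OF flow[OF t, of x] this]
    show "((\<lambda>t. f t x - w \<bullet> r t) has_real_derivative 0) (at t within {0..})"
      by (simp add: w)
  qed simp
  then have const: "f t x = f 0 x - w \<bullet> r 0 + w \<bullet> r t" if "0 \<le> t" for t
    using that by (metis add.commute atLeast_iff diff_add_cancel order_refl)
  have "((\<lambda>t. \<Sum>a\<in>UNIV. w $ a * r t $ a) \<longlongrightarrow> (\<Sum>a\<in>UNIV. w $ a * 0)) at_top"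
    by (intro tendsto_intros r_lim)
  then have "((\<lambda>t. w \<bullet> r t) \<longlongrightarrow> 0) at_top"
    by (simp add: inner_vec_def)
  from tendsto_add[OF tendsto_const this, of "f 0 x - w \<bullet> r 0"]
  have "((\<lambda>t. f 0 x - w \<bullet> r 0 + w \<bullet> r t) \<longlongrightarrow> f 0 x - w \<bullet> r 0) at_top"
    by (simp only: add_0_right)
  then have "((\<lambda>t. f t x) \<longlongrightarrow> f 0 x - w \<bullet> r 0) at_top"
  proof (rule Lim_transform_eventually)
    show "\<forall>\<^sub>F t in at_top. f 0 x - w \<bullet> r 0 + w \<bullet> r t = f t x"
      using eventually_ge_at_top[of 0] by (rule eventually_mono) (rule const[symmetric])
  qed
  then show ?thesis
    by (simp add: inner_vec_def w_def r_def)
qed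

text \<open>This is the variance of f(x) - sum_a w_a f(X a) under the kernel
  \<open>\<kappa>\<close>, with the functional applied to one argument after the other. Symmetry of
  \<open>\<Theta>\<close> identifies row and column, and symmetry of \<open>\<kappa>\<close> merges
  the two cross terms.\<close>

lemma trained_variance_eq:
  fixes X :: "'m::finite \<Rightarrow> 'x"
  assumes pos_def: "positive_definite (kernel_matrix \<Theta> X)"
    and sym: "\<And>x x'. \<Theta> x x' = \<Theta> x' x" "\<And>x x'. \<kappa> x x' = \<kappa> x' x"
    and w: "w = matrix_inv (kernel_matrix \<Theta> X) *v kernel_row \<Theta> x X"
  shows "trained_variance \<kappa> \<Theta> X x = \<kappa> x x - (\<Sum>a\<in>UNIV. w $ a * \<kappa> x (X a)) -
    (\<Sum>a\<in>UNIV. w $ a * (\<kappa> (X a) x - (\<Sum>b\<in>UNIV. w $ b * \<kappa> (X a) (X b))))"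
proof -
  let ?A = "kernel_matrix \<Theta> X" and ?Ti = "matrix_inv (kernel_matrix \<Theta> X)"
  have row: "kernel_row \<Theta> x X = ?A *v w"
    unfolding w by (simp add: positive_definite_matrix_inv[OF pos_def])
  have col: "kernel_col \<Theta> X x = kernel_row \<Theta> x X"
    by (simp add: kernel_col_def kernel_row_def sym(1)[of x])
  have dual: "kernel_row \<Theta> x X \<bullet> (?Ti *v u) = w \<bullet> u" for u
    unfolding row positive_definite_symmetric[OF pos_def] positive_definite_matrix_inv[OF pos_def] ..
  have "trained_variance \<kappa> \<Theta> X x =
      \<kappa> x x + w \<bullet> (kernel_matrix \<kappa> X *v w) - 2 * (w \<bullet> kernel_col \<kappa> X x)"
    by (simp add: trained_variance_def Let_def dual col w[symmetric])
  also have "w \<bullet> (kernel_matrix \<kappa> X *v w) =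
      (\<Sum>a\<in>UNIV. w $ a * (\<Sum>b\<in>UNIV. w $ b * \<kappa> (X a) (X b)))"
    by (simp add: inner_vec_def kernel_matrix_def matrix_vector_mult_def mult.commute)
  also have "w \<bullet> kernel_col \<kappa> X x = (\<Sum>a\<in>UNIV. w $ a * \<kappa> x (X a))"
    by (simp add: inner_vec_def kernel_col_def sym(2)[of "X _" x])
  also have "\<kappa> x x + (\<Sum>a\<in>UNIV. w $ a * (\<Sum>b\<in>UNIV. w $ b * \<kappa> (X a) (X b))) -
      2 * (\<Sum>a\<in>UNIV. w $ a * \<kappa> x (X a)) =
    \<kappa> x x - (\<Sum>a\<in>UNIV. w $ a * \<kappa> x (X a)) -
    (\<Sum>a\<in>UNIV. w $ a * (\<kappa> (X a) x - (\<Sum>b\<in>UNIV. w $ b * \<kappa> (X a) (X b))))"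
    unfolding right_diff_distrib[of "w $ _"] sum_subtractf by (simp add: sym(2)[of "X _" x])
  finally show ?thesis .
qed

section \<open>Prediction error and ensemble variance\<close>

lemma sample_variance_affine:
  assumes "0 \<le> v"
  shows "sample_variance K (\<lambda>k. sqrt v * z k + b) = v * sample_variance K z"
proof -
  define m where "m = 1 / real (K + 1) * (\<Sum>j=1..K+1. z j)"
  have "1 / real (K + 1) * (\<Sum>j=1..K+1. sqrt v * z j + b) = sqrt v * m + b"
    unfolding m_def sum.distrib sum_distrib_left[symmetric]
    by (simp add: field_simps del: sum.cl_ivl_Suc)
  then have "(sqrt v * z k + b - 1 / real (K + 1) * (\<Sum>j=1..K+1. sqrt v * z j + b))\<^sup>2 = v * (z k - m)\<^sup>2" for k
    using assms by (simp add: power_mult_distrib flip: right_diff_distrib)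
  then show ?thesis
    unfolding sample_variance_def m_def[symmetric]
    by (simp add: sum_distrib_left[symmetric] del: sum.cl_ivl_Suc)
qed

lemma sample_variance_cong:
  assumes "\<And>k. k \<in> {1..K+1} \<Longrightarrow> y k = z k"
  shows "sample_variance K y = sample_variance K z"
proof -
  have "(\<Sum>j=1..K+1. y j) = (\<Sum>j=1..K+1. z j)"
    using assms by (intro sum.cong) auto
  then show ?thesis
    unfolding sample_variance_def using assms by (intro arg_cong2[where f = "(*)"] sum.cong) auto
qed

text \<open>A Gaussian process is tested by sums over sets of points, and \<open>x\<close> may
  itself be a training point. The coefficients of g(x) - sum_a w_a g(X a) are therefore collected
  point by point.\<close>

lemma sum_kernel_weights:
  fixes w :: "real^'m::finite" and X :: "'m \<Rightarrow> 'x" and x :: 'x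
  defines "c \<equiv> \<lambda>s. (if s = x then 1 else 0) - (\<Sum>a\<in>UNIV. if s = X a then w $ a else 0)"
  shows "(\<Sum>s\<in>insert x (range X). c s * g s) = g x - (\<Sum>a\<in>UNIV. w $ a * g (X a))"
proof -
  let ?S = "insert x (range X)"
  have "(\<Sum>s\<in>?S. c s * g s) =
      (\<Sum>s\<in>?S. if s = x then g s else 0) - (\<Sum>s\<in>?S. \<Sum>a\<in>UNIV. if s = X a then w $ a * g s else 0)"
    unfolding sum_subtractf[symmetric]
    by (intro sum.cong refl) (auto simp: c_def left_diff_distrib sum_distrib_right intro!: sum.cong)
  also have "(\<Sum>s\<in>?S. if s = x then g s else 0) = g x"
    by (subst sum.delta) auto
  also have "(\<Sum>s\<in>?S. \<Sum>a\<in>UNIV. if s = X a then w $ a * g s else 0) =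
      (\<Sum>a\<in>UNIV. \<Sum>s\<in>?S. if s = X a then w $ a * g s else 0)"
    by (rule sum.swap)
  also have "\<dots> = (\<Sum>a\<in>UNIV. w $ a * g (X a))"
    by (intro sum.cong refl, subst sum.delta) auto
  finally show ?thesis .
qed

lemma scaled_chi_squared:
  "distr (\<Pi>\<^sub>M i\<in>{1..K}. std_normal_distribution) borel (\<lambda>z. b * (\<Sum>i=1..K. (z i)\<^sup>2)) =
    distr (chi_squared K) borel (\<lambda>y. b * y)"
  unfolding chi_squared_def by (subst distr_distr) (auto simp: comp_def)

theorem theorem3p4:
  fixes \<phi> :: "real \<Rightarrow> real" and \<sigma>w \<sigma>b :: real and L K :: nat
    and X :: "'m::finite \<Rightarrow> real^'d::finite" and Y :: "'m \<Rightarrow> real"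
    and \<kappa> \<Theta> :: "real^'d \<Rightarrow> real^'d \<Rightarrow> real"
    and \<Theta>K :: "nat \<Rightarrow> nat \<Rightarrow> real^'d \<Rightarrow> real^'d \<Rightarrow> real"
    and M :: "'w measure" and N :: "'v measure"
    and U :: "real \<Rightarrow> nat \<Rightarrow> real^'d \<Rightarrow> 'w \<Rightarrow> real"
    and G :: "nat \<Rightarrow> real^'d \<Rightarrow> 'w \<Rightarrow> real"
    and F :: "nat \<Rightarrow> real \<Rightarrow> real^'d \<Rightarrow> 'v \<Rightarrow> real"
    and x :: "real^'d"
  assumes K: "K \<ge> 1" and L: "L \<ge> 1"
    and lipschitz: "\<exists>C. C-lipschitz_on UNIV \<phi>"
    and nngp: "is_nngp_kernel \<phi> \<sigma>w \<sigma>b L \<kappa>"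
    and ntk: "is_ntk \<phi> \<sigma>w \<sigma>b L 1 (\<lambda>_ _. \<Theta>)"
    and ntk_K: "is_ntk \<phi> \<sigma>w \<sigma>b L K \<Theta>K"
    and pos_def: "positive_definite (kernel_matrix \<Theta> X)"
    and M: "prob_space M" and N: "prob_space N"
    and U_init: "is_initial_limit \<phi> \<sigma>w \<sigma>b L K M (U 0)"
    and G_init: "is_initial_limit \<phi> \<sigma>w \<sigma>b L K M G"
    and UG_indep:
      "prob_space.indep_var M
         (\<Pi>\<^sub>M s\<in>{1..K} \<times> UNIV. borel) (\<lambda>\<omega>. \<lambda>(i, x)\<in>{1..K} \<times> UNIV. U 0 i x \<omega>)
         (\<Pi>\<^sub>M s\<in>{1..K} \<times> UNIV. borel) (\<lambda>\<omega>. \<lambda>(i, x)\<in>{1..K} \<times> UNIV. G i x \<omega>)"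
    and U_flow:
      "\<And>\<omega>. \<omega> \<in> space M \<Longrightarrow>
         ntk_gradient_flow \<Theta>K K X (\<lambda>i a. G i (X a) \<omega>) (\<lambda>t i x. U t i x \<omega>)"
    and F_init: "\<And>k. k \<in> {1..K+1} \<Longrightarrow> is_initial_limit \<phi> \<sigma>w \<sigma>b L 1 N (\<lambda>_. F k 0)"
    and F_gp: "\<And>k. k \<in> {1..K+1} \<Longrightarrow> centered_gaussian_process N \<kappa> (F k 0)"
    and F_indep:
      "prob_space.indep_vars N (\<lambda>_. \<Pi>\<^sub>M x\<in>UNIV. borel) (\<lambda>k \<omega> x. F k 0 x \<omega>) {1..K+1}"
    and F_flow:
      "\<And>k \<omega>. k \<in> {1..K+1} \<Longrightarrow> \<omega> \<in> space N \<Longrightarrow>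
         ntk_gradient_flow (\<lambda>_ _. \<Theta>) 1 X (\<lambda>_. Y) (\<lambda>t _ x. F k t x \<omega>)"
  defines "half_mse \<equiv>
      \<lambda>\<omega>. 1 / 2 * mean_squared_error K (\<lambda>i. Lim at_top (\<lambda>t. U t i x \<omega>)) (\<lambda>i. G i x \<omega>)"
    and "ensemble_var \<equiv> \<lambda>\<omega>. sample_variance K (\<lambda>k. Lim at_top (\<lambda>t. F k t x \<omega>))"
  shows "half_mse \<in> borel_measurable M \<and> ensemble_var \<in> borel_measurable N \<and>
    distr M borel half_mse = distr N borel ensemble_var \<and>
    distr N borel ensemble_var =
      distr (chi_squared K) borel (\<lambda>z. trained_variance \<kappa> \<Theta> X x / real K * z)"
proof -
  interpret M: prob_space M by (rule M)
  interpret N: prob_space N by (rule N)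
  obtain C where "C-lipschitz_on UNIV \<phi>"
    using lipschitz by blast
  then have \<phi>: "\<phi> \<in> borel_measurable borel"
    by (intro borel_measurable_continuous_onI lipschitz_on_continuous_on)
  \<comment> \<open>\<open>w\<close> holds the kernel regression weights at \<open>x\<close>, and
    \<open>c\<close> is the functional that takes an initial function to its value at
    \<open>x\<close> minus the regression of its training values.\<close>
  define w where "w = matrix_inv (kernel_matrix \<Theta> X) *v kernel_row \<Theta> x X"
  define S where "S = insert x (range X)"
  define c where "c s = (if s = x then 1 else 0) - (\<Sum>a\<in>UNIV. if s = X a then w $ a else 0)" for s
  define v where "v = trained_variance \<kappa> \<Theta> X x"
  have S: "finite S"
    by (simp add: S_def)
  have lin: "(\<Sum>s\<in>S. c s * g s) = g x - (\<Sum>a\<in>UNIV. w $ a * g (X a))" for g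
    unfolding S_def c_def by (rule sum_kernel_weights)
  \<comment> \<open>Applying \<open>lin\<close> in each argument of the kernel shows that
    \<open>v\<close> is the variance of the functional \<open>c\<close> of a Gaussian process with
    kernel \<open>\<kappa>\<close>.\<close>
  have v_eq: "(\<Sum>s\<in>S. \<Sum>s'\<in>S. c s * c s' * \<kappa> s s') = v"
    unfolding mult.assoc sum_distrib_left[symmetric] lin v_def
    by (rule trained_variance_eq[OF pos_def ntk_symmetric[OF ntk] nngp_kernel_symmetric[OF nngp] w_def,
        symmetric])
  have F1: "is_initial_limit \<phi> \<sigma>w \<sigma>b L 1 N (\<lambda>_. F 1 0)" "centered_gaussian_process N \<kappa> (F 1 0)"
    using F_init[of 1] F_gp[of 1] by simp_all
  have v_nonneg: "0 \<le> v"
    using gaussian_process_linear_combination(2)[OF F1(2) S, of c] by (simp add: v_eq)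

  \<comment> \<open>The labels are the training values of \<open>G\<close>, so the label term and -
    G(x) together form the functional \<open>c\<close> of \<open>G\<close>. The error is a
    difference of the same functional of two initial functions.\<close>
  have U_lim: "Lim at_top (\<lambda>t. U t i x \<omega>) - G i x \<omega> =
      (\<Sum>s\<in>S. c s * U 0 i s \<omega>) - (\<Sum>s\<in>S. c s * G i s \<omega>)"
    if i: "i \<in> {1..K}" and \<omega>: "\<omega> \<in> space M" for i \<omega>
  proof -
    have "((\<lambda>s. U s i y \<omega>) has_real_derivative
        - (\<Sum>a\<in>UNIV. \<Theta> y (X a) * (U t i (X a) \<omega> - G i (X a) \<omega>))) (at t within {0..})"
      if t: "0 \<le> t" for y t
    proof -
      have "(\<Sum>j=1..K. \<Sum>a\<in>UNIV. \<Theta>K i j y (X a) * (U t j (X a) \<omega> - G j (X a) \<omega>)) =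
          (\<Sum>j=1..K. if i = j then \<Sum>a\<in>UNIV. \<Theta> y (X a) * (U t j (X a) \<omega> - G j (X a) \<omega>) else 0)"
        by (intro sum.cong refl) (simp add: ntk_multi_output[OF L ntk ntk_K i])
      also have "\<dots> = (\<Sum>a\<in>UNIV. \<Theta> y (X a) * (U t i (X a) \<omega> - G i (X a) \<omega>))"
        using i by simp
      finally have rhs: "(\<Sum>j=1..K. \<Sum>a\<in>UNIV. \<Theta>K i j y (X a) * (U t j (X a) \<omega> - G j (X a) \<omega>)) =
          (\<Sum>a\<in>UNIV. \<Theta> y (X a) * (U t i (X a) \<omega> - G i (X a) \<omega>))" .
      have "((\<lambda>s. U s i y \<omega>) has_real_derivative
          - (\<Sum>j=1..K. \<Sum>a\<in>UNIV. \<Theta>K i j y (X a) * (U t j (X a) \<omega> - G j (X a) \<omega>))) (at t within {0..})"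
        using U_flow[OF \<omega>] i t unfolding ntk_gradient_flow_def by blast
      then show ?thesis
        by (simp only: rhs)
    qed
    from scalar_gradient_flow_limit[where f = "\<lambda>t y. U t i y \<omega>", OF pos_def this, of x]
    have "Lim at_top (\<lambda>t. U t i x \<omega>) =
        U 0 i x \<omega> - (\<Sum>a\<in>UNIV. w $ a * (U 0 i (X a) \<omega> - G i (X a) \<omega>))"
      unfolding w_def by (intro tendsto_Lim) auto
    then show ?thesis
      by (simp add: lin right_diff_distrib sum_subtractf)
  qed
  \<comment> \<open>The labels contribute only a shift that is the same for all ensemble
    members.\<close>
  have F_lim: "Lim at_top (\<lambda>t. F k t x \<omega>) = (\<Sum>s\<in>S. c s * F k 0 s \<omega>) + (\<Sum>a\<in>UNIV. w $ a * Y a)"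
    if k: "k \<in> {1..K+1}" and \<omega>: "\<omega> \<in> space N" for k \<omega>
  proof -
    have "((\<lambda>s. F k s y \<omega>) has_real_derivative
        - (\<Sum>a\<in>UNIV. \<Theta> y (X a) * (F k t (X a) \<omega> - Y a))) (at t within {0..})"
      if t: "0 \<le> t" for y t
      using F_flow[OF k \<omega>] t unfolding ntk_gradient_flow_def by simp
    from scalar_gradient_flow_limit[where f = "\<lambda>t y. F k t y \<omega>", OF pos_def this, of x]
    have "Lim at_top (\<lambda>t. F k t x \<omega>) =
        F k 0 x \<omega> - (\<Sum>a\<in>UNIV. w $ a * (F k 0 (X a) \<omega> - Y a))"
      unfolding w_def by (intro tendsto_Lim) auto
    then show ?thesis
      by (simp add: lin right_diff_distrib sum_subtractf)
  qed

  have UG_measurable: "U 0 i s \<in> borel_measurable M" "G i s \<in> borel_measurable M" if "i \<in> {1..K}" for i s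
    using that U_init G_init by (auto simp: is_initial_limit_def converges_fdd_def)
  \<comment> \<open>The Boolean tells \<open>U\<close> from \<open>G\<close>; the aim is that these
    2 K variables are i.i.d. normal of variance \<open>v\<close>.\<close>
  define Z where "Z p \<omega> = (if snd p then \<Sum>s\<in>S. c s * U 0 (fst p) s \<omega> else \<Sum>s\<in>S. c s * G (fst p) s \<omega>)"
    for p \<omega>
  let ?I = "{1..K} \<times> (UNIV :: bool set)"
  have Z_measurable: "Z p \<in> borel_measurable M" if "p \<in> ?I" for p
    using that unfolding Z_def[abs_def]
    by (cases "snd p") (auto intro!: borel_measurable_sum borel_measurable_times UG_measurable)
  \<comment> \<open>The blocks of \<open>U\<close> and \<open>G\<close> factor by their assumed
    independence. Within a block the outputs factor by the infinite-width limit.\<close>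
  have Z_product: "M.expectation (\<lambda>\<omega>. \<Prod>p\<in>?I. h p (Z p \<omega>)) = (\<Prod>p\<in>?I. \<integral>y. h p y \<partial>centered_normal v)"
    if h: "\<And>p. continuous_on UNIV (h p)" "\<And>p y. \<bar>h p y\<bar> \<le> 1" for h :: "nat \<times> bool \<Rightarrow> real \<Rightarrow> real"
  proof -
    have h_measurable: "h p \<in> borel_measurable borel" for p
      using h(1) by (rule borel_measurable_continuous_onI)
    have split: "(\<Prod>p\<in>?I. f p) = (\<Prod>i\<in>{1..K}. f (i, True)) * (\<Prod>i\<in>{1..K}. f (i, False))"
      for f :: "nat \<times> bool \<Rightarrow> real"
      using prod.cartesian_product[of "\<lambda>i b. f (i, b)" UNIV "{1..K}"]
      by (simp add: UNIV_bool prod.distrib mult.commute)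
    let ?P = "\<Pi>\<^sub>M s\<in>{1..K} \<times> (UNIV :: (real^'d) set). (borel :: real measure)"
    let ?g = "\<lambda>b f. \<Prod>i\<in>{1..K}. h (i, b) (\<Sum>s\<in>S. c s * f (i, s))"
    have g_measurable: "?g b \<in> borel_measurable ?P" for b
      by (intro borel_measurable_prod measurable_compose[OF _ h_measurable] borel_measurable_sum
          borel_measurable_times borel_measurable_const measurable_component_singleton) auto
    have "M.indep_var borel (?g True \<circ> (\<lambda>\<omega>. \<lambda>(i, x)\<in>{1..K} \<times> UNIV. U 0 i x \<omega>))
        borel (?g False \<circ> (\<lambda>\<omega>. \<lambda>(i, x)\<in>{1..K} \<times> UNIV. G i x \<omega>))"
      by (rule M.indep_var_compose[OF UG_indep g_measurable g_measurable])
    moreover have "?g True \<circ> (\<lambda>\<omega>. \<lambda>(i, x)\<in>{1..K} \<times> UNIV. U 0 i x \<omega>) =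
        (\<lambda>\<omega>. \<Prod>i\<in>{1..K}. h (i, True) (Z (i, True) \<omega>))"
      by (intro ext) (auto simp: Z_def intro!: prod.cong)
    moreover have "?g False \<circ> (\<lambda>\<omega>. \<lambda>(i, x)\<in>{1..K} \<times> UNIV. G i x \<omega>) =
        (\<lambda>\<omega>. \<Prod>i\<in>{1..K}. h (i, False) (Z (i, False) \<omega>))"
      by (intro ext) (auto simp: Z_def intro!: prod.cong)
    ultimately have indep: "M.indep_var borel (\<lambda>\<omega>. \<Prod>i\<in>{1..K}. h (i, True) (Z (i, True) \<omega>))
        borel (\<lambda>\<omega>. \<Prod>i\<in>{1..K}. h (i, False) (Z (i, False) \<omega>))"
      by simp
    have integrable: "integrable M (\<lambda>\<omega>. \<Prod>i\<in>{1..K}. h (i, b) (Z (i, b) \<omega>))" for b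
    proof (rule M.integrable_const_bound[where B = 1])
      show "AE \<omega> in M. norm (\<Prod>i\<in>{1..K}. h (i, b) (Z (i, b) \<omega>)) \<le> 1"
        using h(2) by (intro AE_I2) (auto simp: abs_prod intro!: prod_le_1)
      show "(\<lambda>\<omega>. \<Prod>i\<in>{1..K}. h (i, b) (Z (i, b) \<omega>)) \<in> borel_measurable M"
        by (intro borel_measurable_prod measurable_compose[OF _ h_measurable] Z_measurable) auto
    qed
    have "M.expectation (\<lambda>\<omega>. \<Prod>i\<in>{1..K}. h (i, True) (Z (i, True) \<omega>)) =
        (\<Prod>i\<in>{1..K}. \<integral>y. h (i, True) y \<partial>centered_normal v)"
      using initial_limit_product_expectation[OF L \<phi> F1 U_init S, of "\<lambda>i. h (i, True)" c] h
      by (simp add: Z_def v_eq)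
    moreover have "M.expectation (\<lambda>\<omega>. \<Prod>i\<in>{1..K}. h (i, False) (Z (i, False) \<omega>)) =
        (\<Prod>i\<in>{1..K}. \<integral>y. h (i, False) y \<partial>centered_normal v)"
      using initial_limit_product_expectation[OF L \<phi> F1 G_init S, of "\<lambda>i. h (i, False)" c] h
      by (simp add: Z_def v_eq)
    ultimately show ?thesis
      unfolding split using M.indep_var_lebesgue_integral[OF indep integrable integrable] by simp
  qed
  have Z_indep: "M.indep_vars (\<lambda>_. borel) Z ?I"
    and Z_law: "\<And>p. p \<in> ?I \<Longrightarrow> distr M borel (Z p) = centered_normal v"
    using M.indep_vars_of_product_expectations[where X = Z and I = ?I and \<mu> = "\<lambda>_. centered_normal v"]
      Z_measurable Z_product real_distribution_centered_normal by auto

  define \<epsilon> where "\<epsilon> i \<omega> = Z (i, True) \<omega> - Z (i, False) \<omega>" for i \<omega>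
  have \<epsilon>_indep: "M.indep_vars (\<lambda>_. borel) \<epsilon> {1..K}"
  proof -
    have "M.indep_vars (\<lambda>i. PiM ({i} \<times> UNIV) (\<lambda>_. borel)) (\<lambda>i \<omega>. restrict (\<lambda>p. Z p \<omega>) ({i} \<times> UNIV)) {1..K}"
      by (rule M.indep_vars_restrict[OF Z_indep]) (auto simp: disjoint_family_on_def)
    then have "M.indep_vars (\<lambda>_. borel) (\<lambda>i \<omega>. (\<lambda>f. f (i, True) - f (i, False))
        (restrict (\<lambda>p. Z p \<omega>) ({i} \<times> UNIV))) {1..K}"
      by (rule M.indep_vars_compose2)
        (intro borel_measurable_diff measurable_component_singleton, auto)
    then show ?thesis
      by (simp add: \<epsilon>_def[abs_def])
  qed
  \<comment> \<open>The coefficients 1 and -1 both have square 1, so the two variances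
    \<open>v\<close> add up.\<close>
  have \<epsilon>_law: "distr M borel (\<epsilon> i) = centered_normal (2 * v)" if i: "i \<in> {1..K}" for i
  proof -
    have "M.indep_vars (\<lambda>_. borel) Z ({i} \<times> UNIV)"
      using Z_indep by (rule M.indep_vars_subset) (use i in auto)
    from M.distr_sum_centered_normal[OF _ this, of "\<lambda>_. v" "\<lambda>p. if snd p then 1 else - 1"]
    have "distr M borel (\<lambda>\<omega>. \<Sum>p\<in>{i} \<times> UNIV. (if snd p then 1 else - 1) * Z p \<omega>) =
        centered_normal (\<Sum>p\<in>{i} \<times> (UNIV :: bool set). (if snd p then 1 else - 1)\<^sup>2 * v)"
      using i Z_law v_nonneg by auto
    moreover have "{i} \<times> (UNIV :: bool set) = {(i, True), (i, False)}"
      by (auto simp: UNIV_bool)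
    ultimately show ?thesis
      by (simp add: \<epsilon>_def[abs_def])
  qed
  let ?h = "\<lambda>z. 1 / 2 * (1 / real K * (\<Sum>i=1..K. (z i)\<^sup>2))"
  have half_mse: "half_mse \<omega> = ?h (\<lambda>i\<in>{1..K}. \<epsilon> i \<omega>)" if "\<omega> \<in> space M" for \<omega>
    unfolding half_mse_def mean_squared_error_def using U_lim[OF _ that]
    by (simp add: \<epsilon>_def Z_def)
  have h_measurable: "?h \<in> borel_measurable (\<Pi>\<^sub>M i\<in>{1..K}. borel)"
    by measurable
  have \<epsilon>_measurable: "(\<lambda>\<omega>. \<lambda>i\<in>{1..K}. \<epsilon> i \<omega>) \<in> measurable M (\<Pi>\<^sub>M i\<in>{1..K}. borel)"
    using \<epsilon>_indep by (intro measurable_restrict) (auto simp: M.indep_vars_def)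
  have half_mse_measurable: "half_mse \<in> borel_measurable M"
    using measurable_compose[OF \<epsilon>_measurable h_measurable]
    by (subst measurable_cong[OF half_mse]) auto
  have half_mse_law: "distr M borel half_mse = distr (chi_squared K) borel (\<lambda>z. v / real K * z)"
  proof -
    have "distr M borel half_mse = distr M borel (\<lambda>\<omega>. ?h (\<lambda>i\<in>{1..K}. \<epsilon> i \<omega>))"
      by (intro distr_cong refl half_mse) auto
    also have "\<dots> = distr (\<Pi>\<^sub>M i\<in>{1..K}. std_normal_distribution) borel
        (\<lambda>z. ?h (\<lambda>i\<in>{1..K}. sqrt (2 * v) * z i))"
      using K by (intro M.distr_of_scaled_std_normal[OF \<epsilon>_indep _ _ \<epsilon>_law h_measurable]) auto
    \<comment> \<open>The factor 1/2 in front of the mean squared error cancels the doubled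
      variance.\<close>
    also have "(\<lambda>z. ?h (\<lambda>i\<in>{1..K}. sqrt (2 * v) * z i)) = (\<lambda>z. v / real K * (\<Sum>i=1..K. (z i)\<^sup>2))"
      using v_nonneg by (simp add: power_mult_distrib sum_distrib_left[symmetric])
    finally show ?thesis
      by (simp only: scaled_chi_squared)
  qed

  define C where "C k \<omega> = (\<Sum>s\<in>S. c s * F k 0 s \<omega>)" for k \<omega>
  have C_indep: "N.indep_vars (\<lambda>_. borel) C {1..K+1}"
    unfolding C_def[abs_def]
    by (rule N.indep_vars_compose2[OF F_indep, where Y = "\<lambda>_ f. \<Sum>s\<in>S. c s * f s"])
      (intro borel_measurable_sum borel_measurable_times borel_measurable_const
        measurable_component_singleton, auto)
  have C_law: "distr N borel (C k) = centered_normal v" if "k \<in> {1..K+1}" for k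
    using gaussian_process_linear_combination(1)[OF F_gp[OF that] S, of c]
    by (simp add: C_def[abs_def] v_eq)
  have ensemble_var: "ensemble_var \<omega> = sample_variance K (\<lambda>k\<in>{1..K+1}. C k \<omega>)"
    if "\<omega> \<in> space N" for \<omega>
  \<comment> \<open>The common shift drops out of the deviations from the mean; the scale is the
    trivial \<open>sqrt 1\<close>.\<close>
  proof -
    let ?b = "\<Sum>a\<in>UNIV. w $ a * Y a"
    have "ensemble_var \<omega> = sample_variance K (\<lambda>k. sqrt 1 * (\<lambda>k\<in>{1..K+1}. C k \<omega>) k + ?b)"
      unfolding ensemble_var_def using F_lim[OF _ that]
      by (intro sample_variance_cong) (simp add: C_def)
    also have "\<dots> = sample_variance K (\<lambda>k\<in>{1..K+1}. C k \<omega>)"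
      by (subst sample_variance_affine) auto
    finally show ?thesis .
  qed
  have var_measurable: "sample_variance K \<in> borel_measurable (\<Pi>\<^sub>M k\<in>{1..K+1}. borel)"
    unfolding sample_variance_def[abs_def]
    by (intro borel_measurable_times borel_measurable_const borel_measurable_sum
        borel_measurable_power borel_measurable_diff measurable_component_singleton)
  have C_measurable: "(\<lambda>\<omega>. \<lambda>k\<in>{1..K+1}. C k \<omega>) \<in> measurable N (\<Pi>\<^sub>M k\<in>{1..K+1}. borel)"
    using C_indep by (intro measurable_restrict) (auto simp: N.indep_vars_def)
  have ensemble_var_measurable: "ensemble_var \<in> borel_measurable N"
    using measurable_compose[OF C_measurable var_measurable]
    by (subst measurable_cong[OF ensemble_var]) auto
  have ensemble_var_law: "distr N borel ensemble_var = distr (chi_squared K) borel (\<lambda>z. v / real K * z)"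
  proof -
    let ?dev = "\<lambda>z :: nat \<Rightarrow> real. \<Sum>i=1..K+1. (z i - 1 / real (K + 1) * (\<Sum>j=1..K+1. z j))\<^sup>2"
    let ?P = "\<Pi>\<^sub>M k\<in>{1..K+1}. std_normal_distribution"
    have "distr N borel ensemble_var = distr N borel (\<lambda>\<omega>. sample_variance K (\<lambda>k\<in>{1..K+1}. C k \<omega>))"
      by (intro distr_cong refl ensemble_var) auto
    also have "\<dots> = distr ?P borel (\<lambda>z. sample_variance K (\<lambda>k\<in>{1..K+1}. sqrt v * z k))"
      by (intro N.distr_of_scaled_std_normal[OF C_indep _ _ C_law var_measurable]) auto
    also have "(\<lambda>z. sample_variance K (\<lambda>k\<in>{1..K+1}. sqrt v * z k)) = (\<lambda>z. v / real K * ?dev z)"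
    proof
      fix z
      have "sample_variance K (\<lambda>k\<in>{1..K+1}. sqrt v * z k) = sample_variance K (\<lambda>k. sqrt v * z k + 0)"
        by (rule sample_variance_cong) simp
      also have "\<dots> = v * sample_variance K z"
        by (rule sample_variance_affine[OF v_nonneg])
      finally show "sample_variance K (\<lambda>k\<in>{1..K+1}. sqrt v * z k) = v / real K * ?dev z"
        by (simp add: sample_variance_def del: sum.cl_ivl_Suc)
    qed
    also have "distr ?P borel (\<lambda>z. v / real K * ?dev z) = distr (distr ?P borel ?dev) borel (\<lambda>y. v / real K * y)"
    proof -
      have "?dev \<in> borel_measurable ?P"
        by (intro borel_measurable_const borel_measurable_sum borel_measurable_times
            borel_measurable_power borel_measurable_diff) auto
      then show ?thesis
        by (subst distr_distr) (auto simp: comp_def)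
    qed
    finally show ?thesis
      by (simp only: distr_sample_variance_std_normal)
  qed
  show ?thesis
    using half_mse_measurable ensemble_var_measurable half_mse_law ensemble_var_law
    by (simp add: v_def)
qed

end
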